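(* Consider an $\mathrm{RBIBD}(v,k,1,r,b)$ whose $b\times v$ incidence matrix $\mathbf X$ has its rows (blocks) ordered so that the $r$ parallel classes appear as $r$ consecutive groups of $\frac vk$ rows each. Let $\mathbf{\Pi}$ be a BIBD permutation matrix corresponding to $\mathbf X$, and let $\mathbf{E}$, $\mathbf{F}$ and $\mathbf{G}$ be possibly-complex Hadamard matrices of size $\frac vk$, $k$ and $r+1$, respectively. Let $\mathbb{F}=\mathbb R$ if $\mathbf E,\mathbf F,\mathbf G$ are all real, and $\mathbb F=\mathbb C$ otherwise. Write $\mathbf{G}=\begin{bmatrix}\mathbf{G}_1&\mathbf{g}_2\end{bmatrix}$ where $\mathbf{G}_1$ is $(r+1)\times r$ and $\mathbf g_2$ is $(r+1)\times1$. For any $l=1,\dotsc,k$, let $$\mathbf{\Psi}_l:=(\mathbf{I}_r\otimes\mathbf{E})(\mathbf{I}_b\otimes\mathbf{f}_l^* )\,\mathbf{\Pi}\,(\mathbf{I}_v\otimes\mathbf{G}_1^* ),$$ where $\mathbf{f}_l$ is the $l$th column of $\mathbf{F}$. Then, for each $l$, the $v(r+1)$ columns of $\mathbf{\Psi}_l$ form a flat ETF for $\mathbb{F}^b$. Moreover, the row spaces of the matrices $\mathbf{\Psi}_1,\dotsc,\mathbf\Psi_k$ are mutually orthogonal and the matrix $$\widetilde{\mathbf{\Psi}}_1=\begin{bmatrix}\mathbf{\Psi}_2\\ \vdots\\ \mathbf{\Psi}_k\\ (\mathbf{E}\otimes\mathbf{F})(\mathbf{I}_v\otimes\mathbf{g}_2^*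 )\end{bmatrix}$$ is a flat Naimark complement of $\mathbf{\Psi}_1$, meaning $\mathbf{\Psi}_1$ is a possibly-complex Hadamard ETF (Hadamard if $\mathbb F=\mathbb R$, complex Hadamard if $\mathbb F=\mathbb C$). In particular, if there exists a (real) Hadamard matrix of size $u$, then there exists a (real) Hadamard ETF with parameters $(d,n)=(u(2u-1),4u^2)$, that is, a Hadamard ETF of $4u^2$ vectors for $\mathbb R^{u(2u-1)}$.
   Context: Let $\mathbb{F}$ be $\mathbb{R}$ or $\mathbb{C}$. A sequence of vectors $\{\varphi_j\}_{j=1}^n$ in $\mathbb{F}^d$ is identified with its synthesis operator, the $d\times n$ matrix $\mathbf\Phi$ whose $j$th column is $\varphi_j$; $\mathbf{\Phi}^*$ is the conjugate transpose. The sequence is an equiangular tight frame (ETF) for $\mathbb{F}^d$, with parameters $(d,n)$, if there exist $\beta>0$, $\gamma\ge0$, $\alpha>0$ such that $\|\varphi_j\|^2=\beta$ for all $j$, $|\langle\varphi_j,\varphi_{j'}\rangle|=\gamma$ for all $j\ne j'$, and $\mathbf{\Phi}\mathbf{\Phi}^*=\alpha\mathbf{I}$. A Naimark complement of such an ETF (with $n>d$) is (the sequence of columns of) an $(n-d)\times n$ matrix $\widetilde{\mathbf{\Phi}}$ over $\mathbb{F}$ such that $\alpha^{-1/2}\begin{bmatrix}\mathbf{\Phi}\\ \widetilde{\mathbf{\Phi}}\end{bmatrix}$ is unitary. A possibly-complex Hadamard matrix of size $m$ is an $m\times m$ real or complex matrix $\mathbf H$ with all entries of modulus one and $\mathbf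 H\mathbf H^*=m\mathbf I$; a (real) Hadamard matrix is one with all entries $\pm1$. An ETF is flat if every entry of its synthesis operator has modulus one. It is (complex) Hadamard if its $d\times n$ synthesis operator is a submatrix of an $n\times n$ (complex) Hadamard matrix. Given integers $v>k>0$, $b>0$, $\lambda$, $r$, a $\mathrm{BIBD}(v,k,\lambda,r,b)$ is a set of $v$ vertices together with $b$ subsets of it (blocks) such that each block contains exactly $k$ vertices, each vertex is in exactly $r$ blocks, and every pair of distinct vertices is in exactly $\lambda$ blocks. Its incidence matrix $\mathbf{X}$ is the $b\times v$ $\{0,1\}$-valued matrix with rows indexed by blocks and columns by vertices. One has $bk=vr$. An $\mathrm{RBIBD}(v,k,\lambda,r,b)$ (resolvable BIBD) is a BIBD whose $b$ blocks can be arranged as $r$ collections (parallel classes) of $\frac br=\frac vk$ blocks each, with each parallel class forming a partition of the vertex set. If $\mathbf X$ is the $b\times v$ incidence matrix of a $\mathrm{BIBD}(v,k,1,r,b)$, a corresponding BIBD permutation matrix is a permutation matrix $\mathbf\Pi$ of size $bk=vr$ such that $\mathbf X=(\mathbf I_b\otimes\mathbf 1_k^{\mathrm T})\,\mathbf\Pi\,(\mathbf I_v\otimes\mathbf 1_r)$, where $\mathbf I_m$ is the $m\times m$ identity, $\mathbf 1_m$ is the $m\times1$ all-ones vector, and $\otimes$ is the Kronecker product. *)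

theory Defs
  imports
    Complex_Main
    "HOL-Combinatorics.Permutations"
    "HOL-Library.Disjoint_Sets"
    "Jordan_Normal_Form.Schur_Decomposition"
    "Jordan_Normal_Form.DL_Submatrix"
begin

text \<open>
  The scalar field is a set \<open>K\<close> of complex numbers, either \<open>\<real>\<close> or \<open>UNIV\<close>: a matrix over the
  reals is a complex matrix whose entries lie in \<open>\<real>\<close>.  All indices start at 0.
\<close>

definition mat_over :: "complex set \<Rightarrow> nat \<Rightarrow> nat \<Rightarrow> complex mat \<Rightarrow> bool" where
  "mat_over K m n A \<longleftrightarrow> A \<in> carrier_mat m n \<and> elements_mat A \<subseteq> K"

definition kron :: "'a::times mat \<Rightarrow> 'a mat \<Rightarrow> 'a mat"  (infixl \<open>\<otimes>\<^sub>k\<close> 72) where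
  "A \<otimes>\<^sub>k B = mat (dim_row A * dim_row B) (dim_col A * dim_col B)
     (\<lambda>(i, j). A $$ (i div dim_row B, j div dim_col B) * B $$ (i mod dim_row B, j mod dim_col B))"

definition col_mat :: "'a mat \<Rightarrow> nat \<Rightarrow> 'a mat" where
  "col_mat A j = mat_of_cols (dim_row A) [col A j]"

definition ones_mat :: "nat \<Rightarrow> nat \<Rightarrow> 'a::one mat" where
  "ones_mat m n = mat m n (\<lambda>_. 1)"

definition permutation_mat :: "nat \<Rightarrow> 'a::zero_neq_one mat \<Rightarrow> bool" where
  "permutation_mat m P \<longleftrightarrow>
     (\<exists>p. p permutes {..<m} \<and> P = mat m m (\<lambda>(i, j). if i = p j then 1 else 0))"

definition unitary_mat :: "nat \<Rightarrow> complex mat \<Rightarrow> bool" where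
  "unitary_mat n U \<longleftrightarrow> U \<in> carrier_mat n n
     \<and> U * mat_adjoint U = 1\<^sub>m n \<and> mat_adjoint U * U = 1\<^sub>m n"

definition row_space_over :: "complex set \<Rightarrow> complex mat \<Rightarrow> complex vec set" where
  "row_space_over K A =
     {transpose_mat A *\<^sub>v x | x. x \<in> carrier_vec (dim_row A) \<and> set\<^sub>v x \<subseteq> K}"

definition orthogonal_sets :: "complex vec set \<Rightarrow> complex vec set \<Rightarrow> bool" where
  "orthogonal_sets U W \<longleftrightarrow> (\<forall>x\<in>U. \<forall>y\<in>W. x \<bullet>c y = 0)"

definition flat_mat :: "complex mat \<Rightarrow> bool" where
  "flat_mat A \<longleftrightarrow> (\<forall>z\<in>elements_mat A. cmod z = 1)"

definition complex_hadamard :: "nat \<Rightarrow> complex mat \<Rightarrow> bool" where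
  "complex_hadamard m H \<longleftrightarrow> H \<in> carrier_mat m m \<and> flat_mat H
     \<and> H * mat_adjoint H = of_nat m \<cdot>\<^sub>m 1\<^sub>m m"

definition real_hadamard :: "nat \<Rightarrow> complex mat \<Rightarrow> bool" where
  "real_hadamard m H \<longleftrightarrow> complex_hadamard m H \<and> elements_mat H \<subseteq> {1, -1}"

text \<open>A sequence of \<open>n\<close> vectors in \<open>K\<^sup>d\<close> is given by the \<open>d\<close> by \<open>n\<close> matrix having it as columns.\<close>

definition etf :: "complex set \<Rightarrow> nat \<Rightarrow> nat \<Rightarrow> complex mat \<Rightarrow> bool" where
  "etf K d n \<Phi> \<longleftrightarrow> mat_over K d n \<Phi> \<and>
     (\<exists>\<beta> \<gamma> \<alpha> :: real. \<beta> > 0 \<and> \<gamma> \<ge> 0 \<and> \<alpha> > 0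
        \<and> (\<forall>j<n. col \<Phi> j \<bullet>c col \<Phi> j = complex_of_real \<beta>)
        \<and> (\<forall>j<n. \<forall>j'<n. j \<noteq> j' \<longrightarrow> cmod (col \<Phi> j \<bullet>c col \<Phi> j') = \<gamma>)
        \<and> \<Phi> * mat_adjoint \<Phi> = complex_of_real \<alpha> \<cdot>\<^sub>m 1\<^sub>m d)"

definition naimark_complement ::
  "complex set \<Rightarrow> nat \<Rightarrow> nat \<Rightarrow> complex mat \<Rightarrow> complex mat \<Rightarrow> bool" where
  "naimark_complement K d n \<Phi> \<Phi>' \<longleftrightarrow> etf K d n \<Phi> \<and> d < n \<and> mat_over K (n - d) n \<Phi>' \<and>
     (\<exists>\<alpha>::real. \<alpha> > 0 \<and> \<Phi> * mat_adjoint \<Phi> = complex_of_real \<alpha> \<cdot>\<^sub>m 1\<^sub>m d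
        \<and> unitary_mat n (complex_of_real (\<alpha> powr (-1/2)) \<cdot>\<^sub>m (\<Phi> @\<^sub>r \<Phi>')))"

definition complex_hadamard_etf :: "nat \<Rightarrow> nat \<Rightarrow> complex mat \<Rightarrow> bool" where
  "complex_hadamard_etf d n \<Phi> \<longleftrightarrow> etf UNIV d n \<Phi>
     \<and> (\<exists>H I J. complex_hadamard n H \<and> \<Phi> = submatrix H I J)"

definition real_hadamard_etf :: "nat \<Rightarrow> nat \<Rightarrow> complex mat \<Rightarrow> bool" where
  "real_hadamard_etf d n \<Phi> \<longleftrightarrow> etf \<real> d n \<Phi>
     \<and> (\<exists>H I J. real_hadamard n H \<and> \<Phi> = submatrix H I J)"

text \<open>
  The blocks form a list, whose order is that of the rows of the incidence matrix.  Repetitions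
  need not be excluded: for \<open>lam = 1\<close> a repeated block would have a single vertex, i.e. \<open>k = 1\<close>,
  but then no block contains two distinct vertices, contradicting \<open>v > k\<close>.
\<close>

definition bibd :: "'a set \<Rightarrow> 'a set list \<Rightarrow> nat \<Rightarrow> nat \<Rightarrow> nat \<Rightarrow> nat \<Rightarrow> nat \<Rightarrow> bool" where
  "bibd V Bs v k lam r b \<longleftrightarrow>
     v > k \<and> k > 0 \<and> b > 0 \<and> finite V \<and> card V = v \<and> length Bs = b
     \<and> (\<forall>B\<in>set Bs. B \<subseteq> V \<and> card B = k)
     \<and> (\<forall>x\<in>V. card {i. i < b \<and> x \<in> Bs ! i} = r)
     \<and> (\<forall>x\<in>V. \<forall>y\<in>V. x \<noteq> y \<longrightarrow> card {i. i < b \<and> x \<in> Bs ! i \<and> y \<in> Bs ! i} = lam)"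

text \<open>
  The map \<open>c\<close> assigns to each block index its parallel class.  The division \<open>v div k\<close> is exact,
  since the blocks in a class partition \<open>V\<close>.
\<close>

definition resolution :: "'a set \<Rightarrow> 'a set list \<Rightarrow> nat \<Rightarrow> nat \<Rightarrow> nat \<Rightarrow> (nat \<Rightarrow> nat) \<Rightarrow> bool" where
  "resolution V Bs v k r c \<longleftrightarrow>
     (\<forall>i<length Bs. c i < r)
     \<and> (\<forall>t<r. let I = {i. i < length Bs \<and> c i = t} in
           card I = v div k \<and> disjoint_family_on (\<lambda>i. Bs ! i) I \<and> (\<Union>i\<in>I. Bs ! i) = V)"

definition rbibd :: "'a set \<Rightarrow> 'a set list \<Rightarrow> nat \<Rightarrow> nat \<Rightarrow> nat \<Rightarrow> nat \<Rightarrow> nat \<Rightarrow> bool" where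
  "rbibd V Bs v k lam r b \<longleftrightarrow> bibd V Bs v k lam r b \<and> (\<exists>c. resolution V Bs v k r c)"

definition consecutive_classes :: "'a set \<Rightarrow> 'a set list \<Rightarrow> nat \<Rightarrow> nat \<Rightarrow> nat \<Rightarrow> bool" where
  "consecutive_classes V Bs v k r \<longleftrightarrow> resolution V Bs v k r (\<lambda>i. i div (v div k))"

definition incidence_mat :: "'a list \<Rightarrow> 'a set list \<Rightarrow> complex mat" where
  "incidence_mat vs Bs = mat (length Bs) (length vs) (\<lambda>(i, j). if vs ! j \<in> Bs ! i then 1 else 0)"

definition bibd_permutation_mat ::
  "nat \<Rightarrow> nat \<Rightarrow> nat \<Rightarrow> nat \<Rightarrow> complex mat \<Rightarrow> complex mat \<Rightarrow> bool" where
  "bibd_permutation_mat v k r b X P \<longleftrightarrow> permutation_mat (b * k) P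
     \<and> X = (1\<^sub>m b \<otimes>\<^sub>k ones_mat 1 k) * P * (1\<^sub>m v \<otimes>\<^sub>k ones_mat r 1)"

text \<open>
  \<open>Psi_mat v r b E F G P l\<close> for \<open>l < k\<close> is built from the column of \<open>F\<close> with 0-based index \<open>l\<close>
  and from the first \<open>r\<close> of the \<open>r + 1\<close> columns of \<open>G\<close>; the remaining column of \<open>G\<close>, with index
  \<open>r\<close>, enters \<open>Psi_compl\<close>.
\<close>

definition Psi_mat ::
  "nat \<Rightarrow> nat \<Rightarrow> nat \<Rightarrow> complex mat \<Rightarrow> complex mat \<Rightarrow> complex mat \<Rightarrow> complex mat \<Rightarrow> nat \<Rightarrow> complex mat"
where
  "Psi_mat v r b E F G P l =
     (let G1 = mat_of_cols (r + 1) (map (col G) [0..<r]) in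
      (1\<^sub>m r \<otimes>\<^sub>k E) * (1\<^sub>m b \<otimes>\<^sub>k mat_adjoint (col_mat F l)) * P * (1\<^sub>m v \<otimes>\<^sub>k mat_adjoint G1))"

definition Psi_compl ::
  "nat \<Rightarrow> nat \<Rightarrow> nat \<Rightarrow> nat \<Rightarrow> complex mat \<Rightarrow> complex mat \<Rightarrow> complex mat \<Rightarrow> complex mat \<Rightarrow> complex mat"
where
  "Psi_compl v k r b E F G P =
     foldr (@\<^sub>r) (map (Psi_mat v r b E F G P) [1..<k])
       ((E \<otimes>\<^sub>k F) * (1\<^sub>m v \<otimes>\<^sub>k mat_adjoint (col_mat G r)))"

end

theory Submission
  imports Defs
begin

text \<open>
  Write \<open>q = v / k\<close>.  The permutation orders the \<open>r\<close> blocks through each vertex \<open>j\<close> and the \<open>k\<close>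
  vertices of each block.  Since each parallel class \<open>c\<close> has exactly one block containing \<open>j\<close>, it
  can be recorded by the rank \<open>\<sigma> c j < r\<close> of that block among the blocks through \<open>j\<close> and by the
  place \<open>w c j < v\<close> of \<open>j\<close> in class \<open>c\<close>: the block has number \<open>w c j div k\<close> in its class and
  \<open>j\<close> has position \<open>w c j mod k\<close> in the block.  The sum defining an entry of \<open>\<Psi>\<^sub>l\<close> then
  has a single nonzero term, a product of an entry of \<open>E\<close>, of \<open>F\<close> and of \<open>G\<close>.
  Inner products of rows factor because \<open>w c\<close> is a bijection.  Those of columns reduce to the
  classes in which two vertices share a block: all of them for equal vertices, exactly one for
  distinct vertices.  The same computation applies to the round-robin schedule on \<open>2 u\<close> vertices,
  which gives the second part without constructing a permutation matrix.
\<close>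

section \<open>Matrix entries and sums over mixed-radix indices\<close>

text \<open>The range splits into \<open>m\<close> consecutive runs of length \<open>n\<close> on
  which the quotient is constant. A Kronecker index thereby becomes a pair of digits, and sums of
  separated terms become products.\<close>

lemma sum_div_mod:
  fixes f :: "nat \<Rightarrow> nat \<Rightarrow> 'a::comm_monoid_add"
  shows "(\<Sum>x<m * n. f (x div n) (x mod n)) = (\<Sum>i<m. \<Sum>j<n. f i j)"
proof (cases "n = 0")
  case False
  have "(\<Sum>x<m * n. f (x div n) (x mod n)) = (\<Sum>i<m. \<Sum>x\<in>{i * n..<i * n + n}. f (x div n) (x mod n))"
    by (rule sum.nat_group[symmetric])
  also have "\<dots> = (\<Sum>i<m. \<Sum>j<n. f i j)"
  proof (rule sum.cong[OF refl])
    fix i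
    have "(\<Sum>x\<in>{i * n..<i * n + n}. f (x div n) (x mod n))
        = (\<Sum>j\<in>{0..<n}. f ((j + i * n) div n) ((j + i * n) mod n))"
      using sum.shift_bounds_nat_ivl[of "\<lambda>x. f (x div n) (x mod n)" 0 "i * n" n]
      by (simp add: add.commute)
    also have "\<dots> = (\<Sum>j<n. f i j)"
      using False by (intro sum.cong) auto
    finally show "(\<Sum>x\<in>{i * n..<i * n + n}. f (x div n) (x mod n)) = (\<Sum>j<n. f i j)" .
  qed
  finally show ?thesis .
qed simp

lemma div_less_of_less_mult: "x < m * n \<Longrightarrow> x div n < (m::nat)"
  by (simp add: less_mult_imp_div_less)

lemma mod_less_of_less_mult: "x < m * n \<Longrightarrow> x mod n < (n::nat)"
  by (cases "n = 0") auto

lemma mult_add_less_mult: "i < m \<Longrightarrow> j < n \<Longrightarrow> i * n + j < m * (n::nat)"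
  by (metis div_less_iff_less_mult div_mult_self3 div_less less_nat_zero_code
      add.right_neutral gr_zeroI)

lemma mod_mult_div_mod:
  fixes x :: nat
  shows "x mod (q * k) div k = x div k mod q" "x mod (q * k) mod k = x mod k"
proof -
  show "x mod (q * k) mod k = x mod k"
    by (simp add: mod_mod_cancel)
  show "x mod (q * k) div k = x div k mod q"
    by (metis add.right_neutral div_mult_self4 mod_by_0 mod_div_trivial
        mod_mult2_eq mod_mult_self1_is_0 mult.commute)
qed

section \<open>Entries of products, adjoints and Kronecker products\<close>

lemma times_mat_entry:
  assumes "A \<in> carrier_mat m n" "B \<in> carrier_mat n p" "i < m" "j < p"
  shows "(A * B) $$ (i, j) = (\<Sum>x<n. A $$ (i, x) * B $$ (x, j))"
  using assms by (auto simp: scalar_prod_def lessThan_atLeast0 intro!: sum.cong)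

lemma adjoint_carrier:
  "A \<in> carrier_mat m n \<Longrightarrow> mat_adjoint A \<in> carrier_mat n m"
  unfolding mat_adjoint_def by auto

lemma adjoint_entry:
  "A \<in> carrier_mat m n \<Longrightarrow> i < n \<Longrightarrow> j < m \<Longrightarrow> mat_adjoint A $$ (i, j) = cnj (A $$ (j, i))"
  unfolding mat_adjoint_def by (auto simp: mat_of_rows_def)

lemma times_adjoint_entry:
  assumes "A \<in> carrier_mat m n" "B \<in> carrier_mat p n" "i < m" "j < p"
  shows "(A * mat_adjoint B) $$ (i, j) = (\<Sum>x<n. A $$ (i, x) * cnj (B $$ (j, x)))"
  using assms
  by (subst times_mat_entry[OF assms(1) adjoint_carrier[OF assms(2)]])
    (auto simp: adjoint_entry intro!: sum.cong)

lemma kron_carrier: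
  "A \<in> carrier_mat m n \<Longrightarrow> B \<in> carrier_mat p s \<Longrightarrow> A \<otimes>\<^sub>k B \<in> carrier_mat (m * p) (n * s)"
  unfolding kron_def by auto

lemma kron_entry:
  "A \<in> carrier_mat m n \<Longrightarrow> B \<in> carrier_mat p s \<Longrightarrow> i < m * p \<Longrightarrow> j < n * s \<Longrightarrow>
    (A \<otimes>\<^sub>k B) $$ (i, j) = A $$ (i div p, j div s) * B $$ (i mod p, j mod s)"
  unfolding kron_def by auto

lemma one_kron_entry:
  fixes B :: "complex mat"
  assumes "B \<in> carrier_mat p s" "i < m * p" "j < m * s"
  shows "(1\<^sub>m m \<otimes>\<^sub>k B) $$ (i, j) = (if i div p = j div s then B $$ (i mod p, j mod s) else 0)"
  using assms by (subst kron_entry[OF _ assms(1), of _ m m])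
    (auto simp: div_less_of_less_mult)

text \<open>The right factor is block diagonal with \<open>v\<close> copies of \<open>B\<close>, so
  column \<open>j\<close> meets only the \<open>p\<close> rows of copy number
  \<open>j div s\<close>.\<close>

lemma times_one_kron_entry:
  fixes B M :: "complex mat"
  assumes M: "M \<in> carrier_mat N (v * p)" and B: "B \<in> carrier_mat p s"
    and i: "i < N" and j: "j < v * s"
  shows "(M * (1\<^sub>m v \<otimes>\<^sub>k B)) $$ (i, j) = (\<Sum>t<p. M $$ (i, j div s * p + t) * B $$ (t, j mod s))"
proof -
  have j': "j div s < v" using j by (rule div_less_of_less_mult)
  have "(M * (1\<^sub>m v \<otimes>\<^sub>k B)) $$ (i, j)
      = (\<Sum>x<v * p. M $$ (i, x) * (1\<^sub>m v \<otimes>\<^sub>k B) $$ (x, j))"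
    by (rule times_mat_entry[OF M kron_carrier[OF one_carrier_mat B] i j])
  also have "\<dots> = (\<Sum>x<v * p. M $$ (i, x div p * p + x mod p) *
      (if x div p = j div s then B $$ (x mod p, j mod s) else 0))"
    by (intro sum.cong refl) (simp add: one_kron_entry[OF B _ j])
  also have "\<dots> = (\<Sum>y<v. \<Sum>t<p. M $$ (i, y * p + t) *
      (if y = j div s then B $$ (t, j mod s) else 0))"
    by (rule sum_div_mod)
  also have "\<dots> = (\<Sum>y<v. if y = j div s then \<Sum>t<p. M $$ (i, y * p + t) * B $$ (t, j mod s) else 0)"
    by (intro sum.cong) auto
  also have "\<dots> = (\<Sum>t<p. M $$ (i, j div s * p + t) * B $$ (t, j mod s))"
    using j' by simp
  finally show ?thesis .
qed

lemma one_kron_times_entry: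
  fixes A M :: "complex mat"
  assumes A: "A \<in> carrier_mat m n" and M: "M \<in> carrier_mat (b * n) N"
    and i: "i < b * m" and j: "j < N"
  shows "((1\<^sub>m b \<otimes>\<^sub>k A) * M) $$ (i, j) = (\<Sum>t<n. A $$ (i mod m, t) * M $$ (i div m * n + t, j))"
proof -
  have i': "i div m < b" using i by (rule div_less_of_less_mult)
  have "((1\<^sub>m b \<otimes>\<^sub>k A) * M) $$ (i, j)
      = (\<Sum>x<b * n. (1\<^sub>m b \<otimes>\<^sub>k A) $$ (i, x) * M $$ (x, j))"
    by (rule times_mat_entry[OF kron_carrier[OF one_carrier_mat A] M i j])
  also have "\<dots> = (\<Sum>x<b * n. (if i div m = x div n then A $$ (i mod m, x mod n) else 0)
      * M $$ (x div n * n + x mod n, j))"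
    by (intro sum.cong refl) (simp add: one_kron_entry[OF A i])
  also have "\<dots> = (\<Sum>y<b. \<Sum>t<n. (if i div m = y then A $$ (i mod m, t) else 0)
      * M $$ (y * n + t, j))"
    by (rule sum_div_mod)
  also have "\<dots> = (\<Sum>y<b. if y = i div m then \<Sum>t<n. A $$ (i mod m, t) * M $$ (y * n + t, j) else 0)"
    by (intro sum.cong) auto
  also have "\<dots> = (\<Sum>t<n. A $$ (i mod m, t) * M $$ (i div m * n + t, j))"
    using i' by simp
  finally show ?thesis .
qed

text \<open>The sole 1 in column \<open>j\<close> lies in row \<open>p j\<close>. With this
  orientation \<open>p\<close> carries flags listed by vertex to flags listed by block in the
  application to designs.\<close>

lemma times_permutation_entry:
  fixes M :: "complex mat"
  assumes M: "M \<in> carrier_mat N m" and p: "p permutes {..<m}"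
    and i: "i < N" and j: "j < m"
  shows "(M * mat m m (\<lambda>(i, j). if i = p j then 1 else 0)) $$ (i, j) = M $$ (i, p j)"
proof -
  have pj: "p j < m" using permutes_in_image[OF p] j by blast
  have "(M * mat m m (\<lambda>(i, j). if i = p j then 1 else 0)) $$ (i, j)
      = (\<Sum>x<m. if x = p j then M $$ (i, x) else 0)"
    unfolding times_mat_entry[OF M mat_carrier i j] using j by (intro sum.cong) auto
  then show ?thesis using pj by simp
qed

section \<open>Vertical stacks of matrices\<close>

lemma append_rows_entry:
  assumes "A \<in> carrier_mat m n" "B \<in> carrier_mat m' n" "i < m + m'" "j < n"
  shows "(A @\<^sub>r B) $$ (i, j) = (if i < m then A $$ (i, j) else B $$ (i - m, j))"
  using assms unfolding append_rows_def by auto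

lemma foldr_append_rows_carrier:
  assumes "set Ms \<subseteq> carrier_mat m n" "L \<in> carrier_mat m' n"
  shows "foldr (@\<^sub>r) Ms L \<in> carrier_mat (length Ms * m + m') n"
  using assms
proof (induction Ms)
  case (Cons M Ms)
  then show ?case
    using carrier_append_rows[of M m n "foldr (@\<^sub>r) Ms L"] by (simp add: add.assoc)
qed simp

lemma foldr_append_rows_entry:
  assumes "set Ms \<subseteq> carrier_mat m n" "L \<in> carrier_mat m' n"
    and "i < length Ms * m + m'" "j < n"
  shows "foldr (@\<^sub>r) Ms L $$ (i, j)
    = (if i < length Ms * m then (Ms ! (i div m)) $$ (i mod m, j) else L $$ (i - length Ms * m, j))"
  using assms
proof (induction Ms arbitrary: i)
  case (Cons M Ms)
  have c: "M \<in> carrier_mat m n" "foldr (@\<^sub>r) Ms L \<in> carrier_mat (length Ms * m + m') n"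
    using Cons.prems foldr_append_rows_carrier[of Ms m n L m'] by auto
  have "foldr (@\<^sub>r) (M # Ms) L $$ (i, j)
      = (if i < m then M $$ (i, j) else foldr (@\<^sub>r) Ms L $$ (i - m, j))"
    using append_rows_entry[OF c, of i j] Cons.prems by simp
  also have "\<dots> = (if i < length (M # Ms) * m then ((M # Ms) ! (i div m)) $$ (i mod m, j)
      else L $$ (i - length (M # Ms) * m, j))"
  proof (cases "i < m")
    case False
    have "foldr (@\<^sub>r) Ms L $$ (i - m, j)
        = (if i - m < length Ms * m then (Ms ! ((i - m) div m)) $$ ((i - m) mod m, j)
          else L $$ (i - m - length Ms * m, j))"
      using Cons.prems False by (intro Cons.IH) auto
    \<comment> \<open>Removing the first matrix lowers the quotient by one only if
      \<open>m > 0\<close>; for \<open>m = 0\<close> no index falls in the listed matrices and both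
      sides read an entry of \<open>L\<close>.\<close>
    moreover have "m > 0 \<Longrightarrow> i div m = Suc ((i - m) div m)" "(i - m) mod m = i mod m"
      using False by (simp_all add: le_div_geq le_mod_geq)
    ultimately show ?thesis using False by (cases "m = 0") auto
  qed auto
  finally show ?case .
qed simp

lemma col_inner_entries:
  assumes "A \<in> carrier_mat m n" "i < n" "j < n"
  shows "col A i \<bullet>c col A j = (\<Sum>x<m. A $$ (x, i) * cnj (A $$ (x, j)))"
  using assms by (auto simp: scalar_prod_def lessThan_atLeast0 intro!: sum.cong)

lemma elements_matE:
  assumes "z \<in> elements_mat A" "A \<in> carrier_mat m n"
  obtains i j where "i < m" "j < n" "z = A $$ (i, j)"
  using assms elements_matD[OF assms(1)] by auto

lemma cnj_in_Reals: "z \<in> \<real> \<Longrightarrow> cnj z \<in> \<real>"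
  by (simp add: Reals_cnj_iff)

lemma col_mat_adjoint:
  assumes "A \<in> carrier_mat m n" "l < n"
  shows "mat_adjoint (col_mat A l) \<in> carrier_mat 1 m"
    and "t < m \<Longrightarrow> mat_adjoint (col_mat A l) $$ (0, t) = cnj (A $$ (t, l))"
proof -
  have c: "col_mat A l \<in> carrier_mat m 1"
    using assms unfolding col_mat_def by auto
  show "mat_adjoint (col_mat A l) \<in> carrier_mat 1 m"
    by (rule adjoint_carrier[OF c])
  show "mat_adjoint (col_mat A l) $$ (0, t) = cnj (A $$ (t, l))" if "t < m"
    using adjoint_entry[OF c, of 0 t] assms that unfolding col_mat_def by (simp add: mat_of_cols_index)
qed

section \<open>Hadamard matrices\<close>

lemma hadamardI:
  assumes "H \<in> carrier_mat m m"
    and "\<And>i j. i < m \<Longrightarrow> j < m \<Longrightarrow> cmod (H $$ (i, j)) = 1"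
    and "\<And>i j. i < m \<Longrightarrow> j < m \<Longrightarrow>
      (\<Sum>x<m. H $$ (i, x) * cnj (H $$ (j, x))) = (if i = j then of_nat m else 0)"
  shows "complex_hadamard m H"
  unfolding complex_hadamard_def flat_mat_def
proof (intro conjI ballI)
  show "H * mat_adjoint H = of_nat m \<cdot>\<^sub>m 1\<^sub>m m"
    using assms adjoint_carrier[OF assms(1)]
    by (intro eq_matI) (auto simp: times_adjoint_entry[OF assms(1) assms(1)] simp del: index_mult_mat(1))
qed (use assms in auto)

context
  fixes H m assumes H: "complex_hadamard m H"
begin

lemma hadamard_carrier: "H \<in> carrier_mat m m"
  using H unfolding complex_hadamard_def by blast

lemma hadamard_cmod: "i < m \<Longrightarrow> j < m \<Longrightarrow> cmod (H $$ (i, j)) = 1"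
  using H unfolding complex_hadamard_def flat_mat_def by blast

lemma hadamard_mult_cnj: "i < m \<Longrightarrow> j < m \<Longrightarrow> cnj (H $$ (i, j)) * H $$ (i, j) = 1"
  using hadamard_cmod[of i j] by (simp add: complex_norm_square[symmetric] mult.commute)

lemma hadamard_row:
  assumes "i < m" "j < m"
  shows "(\<Sum>x<m. H $$ (i, x) * cnj (H $$ (j, x))) = (if i = j then of_nat m else 0)"
proof -
  have "(H * mat_adjoint H) $$ (i, j) = (of_nat m \<cdot>\<^sub>m 1\<^sub>m m) $$ (i, j)"
    using H unfolding complex_hadamard_def by simp
  then show ?thesis
    using assms by (simp add: times_adjoint_entry[OF hadamard_carrier hadamard_carrier] del: index_mult_mat(1))
qed

text \<open>The definition gives orthogonal rows. A right inverse of a square matrix is also a left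
  inverse, which yields orthogonal columns; the inverse involves \<open>1 / m\<close>, hence the
  separate case of size 0.\<close>

lemma hadamard_adjoint_mult: "mat_adjoint H * H = of_nat m \<cdot>\<^sub>m 1\<^sub>m m"
proof (cases "m = 0")
  case True
  then show ?thesis using hadamard_carrier adjoint_carrier[OF hadamard_carrier]
    by (intro eq_matI) auto
next
  case False
  note c = hadamard_carrier adjoint_carrier[OF hadamard_carrier]
  define A where "A = (1 / of_nat m) \<cdot>\<^sub>m mat_adjoint H"
  have A: "A \<in> carrier_mat m m" using c by (simp add: A_def)
  have "H * A = (1 / of_nat m) \<cdot>\<^sub>m (H * mat_adjoint H)"
    unfolding A_def using mult_smult_distrib[OF c] by simp
  also have "\<dots> = 1\<^sub>m m"
    using H False unfolding complex_hadamard_def by (auto intro!: eq_matI)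
  finally have "A * H = 1\<^sub>m m"
    by (rule mat_mult_left_right_inverse[OF c(1) A])
  moreover have "mat_adjoint H = of_nat m \<cdot>\<^sub>m A"
    using False by (auto simp: A_def intro!: eq_matI)
  ultimately show ?thesis
    using mult_smult_assoc_mat[OF A c(1)] by simp
qed

lemma hadamard_col:
  assumes "i < m" "j < m"
  shows "(\<Sum>x<m. cnj (H $$ (x, i)) * H $$ (x, j)) = (if i = j then of_nat m else 0)"
proof -
  have "(mat_adjoint H * H) $$ (i, j) = (of_nat m \<cdot>\<^sub>m 1\<^sub>m m) $$ (i, j)"
    by (simp add: hadamard_adjoint_mult)
  moreover have "(mat_adjoint H * H) $$ (i, j) = (\<Sum>x<m. cnj (H $$ (x, i)) * H $$ (x, j))"
    using assms hadamard_carrier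
    by (subst times_mat_entry[OF adjoint_carrier[OF hadamard_carrier] hadamard_carrier])
      (auto simp: adjoint_entry intro!: sum.cong)
  ultimately show ?thesis using assms by simp
qed

end

text \<open>A real number of modulus one is 1 or -1, so entries in the field \<real> suffice to pass
  from a complex to a real Hadamard matrix.\<close>

lemma real_hadamardI:
  assumes H: "complex_hadamard m H" and "elements_mat H \<subseteq> \<real>"
  shows "real_hadamard m H"
proof -
  have "z \<in> {1, -1}" if "z \<in> elements_mat H" for z
  proof -
    from that assms obtain x where x: "z = complex_of_real x" by (auto elim!: Reals_cases)
    moreover have "cmod z = 1"
      using H that unfolding complex_hadamard_def flat_mat_def by blast
    ultimately have "\<bar>x\<bar> = 1" by simp
    then have "x = 1 \<or> x = -1" by linarith
    then show ?thesis using x by auto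
  qed
  then show ?thesis using H unfolding real_hadamard_def by blast
qed

text \<open>Inner products of rows factor digit by digit, and two row indices agree exactly when
  both digits do.\<close>

lemma complex_hadamard_kron:
  assumes A: "complex_hadamard m A" and B: "complex_hadamard n B"
  shows "complex_hadamard (m * n) (A \<otimes>\<^sub>k B)"
proof (rule hadamardI)
  note c = hadamard_carrier[OF A] hadamard_carrier[OF B]
  show "A \<otimes>\<^sub>k B \<in> carrier_mat (m * n) (m * n)"
    by (rule kron_carrier[OF c])
  fix i j assume ij: "i < m * n" "j < m * n"
  note d = ij[THEN div_less_of_less_mult] ij[THEN mod_less_of_less_mult]
  show "cmod ((A \<otimes>\<^sub>k B) $$ (i, j)) = 1"
    using d ij by (simp add: kron_entry[OF c] norm_mult hadamard_cmod[OF A] hadamard_cmod[OF B])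
  have "(\<Sum>x<m * n. (A \<otimes>\<^sub>k B) $$ (i, x) * cnj ((A \<otimes>\<^sub>k B) $$ (j, x)))
      = (\<Sum>x<m * n. (A $$ (i div n, x div n) * cnj (A $$ (j div n, x div n)))
          * (B $$ (i mod n, x mod n) * cnj (B $$ (j mod n, x mod n))))"
    using ij by (intro sum.cong) (simp_all add: kron_entry[OF c] mult_ac)
  also have "\<dots> = (\<Sum>x<m. \<Sum>y<n. (A $$ (i div n, x) * cnj (A $$ (j div n, x)))
          * (B $$ (i mod n, y) * cnj (B $$ (j mod n, y))))"
    by (rule sum_div_mod)
  also have "\<dots> = (\<Sum>x<m. A $$ (i div n, x) * cnj (A $$ (j div n, x)))
      * (\<Sum>y<n. B $$ (i mod n, y) * cnj (B $$ (j mod n, y)))"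
    by (rule sum_product[symmetric])
  also have "\<dots> = (if i = j then of_nat (m * n) else 0)"
    using d by (auto simp: hadamard_row[OF A] hadamard_row[OF B]) (metis div_mult_mod_eq)
  finally show "(\<Sum>x<m * n. (A \<otimes>\<^sub>k B) $$ (i, x) * cnj ((A \<otimes>\<^sub>k B) $$ (j, x)))
      = (if i = j then of_nat (m * n) else 0)" .
qed

lemma complex_hadamard_unitary:
  assumes H: "complex_hadamard m H" and m: "m > 0"
  shows "unitary_mat m (complex_of_real (real m powr (-1/2)) \<cdot>\<^sub>m H)"
proof -
  define z where "z = complex_of_real (real m powr (-1/2))"
  note c = hadamard_carrier[OF H]
  note c' = adjoint_carrier[OF c]
  \<comment> \<open>The scalar \<open>z\<close> is the inverse square root of \<open>m\<close>.
    Being real, it passes through the adjoint unconjugated.\<close>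
  have "real m powr (-1/2) * real m powr (-1/2) = 1 / real m"
    using m by (simp add: powr_add[symmetric] powr_minus_divide)
  then have z: "z * z * of_nat m = 1"
    using m by (simp add: z_def of_real_mult[symmetric] del: of_real_mult)
  have adj: "mat_adjoint (z \<cdot>\<^sub>m H) = z \<cdot>\<^sub>m mat_adjoint H"
    using c c' adjoint_carrier[of "z \<cdot>\<^sub>m H" m m]
    by (intro eq_matI) (auto simp: adjoint_entry[of _ m m] z_def)
  have "(z \<cdot>\<^sub>m H) * (z \<cdot>\<^sub>m mat_adjoint H) = (z * z) \<cdot>\<^sub>m (H * mat_adjoint H)"
    using mult_smult_assoc_mat[OF c smult_carrier_mat[OF c']] mult_smult_distrib[OF c c']
    by (auto simp: mult.assoc intro!: eq_matI)
  moreover have "(z \<cdot>\<^sub>m mat_adjoint H) * (z \<cdot>\<^sub>m H) = (z * z) \<cdot>\<^sub>m (mat_adjoint H * H)"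
    using mult_smult_assoc_mat[OF c' smult_carrier_mat[OF c]] mult_smult_distrib[OF c' c]
    by (auto simp: mult.assoc intro!: eq_matI)
  moreover have "H * mat_adjoint H = of_nat m \<cdot>\<^sub>m 1\<^sub>m m"
    using H unfolding complex_hadamard_def by simp
  moreover have "(z * z) \<cdot>\<^sub>m (of_nat m \<cdot>\<^sub>m 1\<^sub>m m) = (1\<^sub>m m :: complex mat)"
    using z by (intro eq_matI) (auto simp: mult.assoc)
  ultimately show ?thesis
    using c hadamard_adjoint_mult[OF H] unfolding unitary_mat_def z_def[symmetric] adj by simp
qed

section \<open>Equiangular tight frames from one-factorization data\<close>

text \<open>This is all that the frame retains of the design. \<open>joined_once\<close> expresses
  \<lambda> = 1: two vertices share a block in exactly one class. The ranks
  \<open>\<sigma> c j\<close> stay below \<open>r\<close>, which reserves the last column of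
  \<open>G\<close> for the complement.\<close>

locale phased_flags =
  fixes q k r :: nat and E F G :: "complex mat" and \<sigma> w :: "nat \<Rightarrow> nat \<Rightarrow> nat"
  assumes pos: "q > 0" "k > 0" "r > 0"
    and E: "complex_hadamard q E" and F: "complex_hadamard k F" and G: "complex_hadamard (r + 1) G"
    and \<sigma>_less: "\<And>c j. c < r \<Longrightarrow> j < q * k \<Longrightarrow> \<sigma> c j < r"
    and \<sigma>_inj: "\<And>j. j < q * k \<Longrightarrow> inj_on (\<lambda>c. \<sigma> c j) {..<r}"
    and w_less: "\<And>c j. c < r \<Longrightarrow> j < q * k \<Longrightarrow> w c j < q * k"
    and w_inj: "\<And>c. c < r \<Longrightarrow> inj_on (w c) {..<q * k}"
    and joined_once: "\<And>j j'. j < q * k \<Longrightarrow> j' < q * k \<Longrightarrow> j \<noteq> j' \<Longrightarrow>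
      \<exists>!c. c < r \<and> w c j div k = w c j' div k"
begin

abbreviation "v \<equiv> q * k"
abbreviation "b \<equiv> r * q"
abbreviation "n \<equiv> v * (r + 1)"

text \<open>Row \<open>a\<close> stands for class \<open>a div q\<close> and row
  \<open>a mod q\<close> of \<open>E\<close>. The phase is the factor of an entry that depends on
  the vertex alone; in \<open>Psi\<close>, column \<open>x\<close> stands for vertex
  \<open>x div (r + 1)\<close> and row \<open>x mod (r + 1)\<close> of \<open>G\<close>.\<close>

definition phase :: "nat \<Rightarrow> nat \<Rightarrow> nat \<Rightarrow> complex" where
  "phase l a j = E $$ (a mod q, w (a div q) j div k) * cnj (F $$ (w (a div q) j mod k, l))"

definition Psi :: "nat \<Rightarrow> complex mat" where
  "Psi l = mat b n (\<lambda>(a, x). phase l a (x div (r + 1))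
     * cnj (G $$ (x mod (r + 1), \<sigma> (a div q) (x div (r + 1)))))"

definition rest :: "complex mat" where
  "rest = mat v n (\<lambda>(a, x). E $$ (a div k, x div (r + 1) div k) * F $$ (a mod k, x div (r + 1) mod k)
     * cnj (G $$ (x mod (r + 1), r)))"

lemma Psi_carrier: "Psi l \<in> carrier_mat b n"
  unfolding Psi_def by simp

lemma rest_carrier: "rest \<in> carrier_mat v n"
  unfolding rest_def by simp

section \<open>Inner products of rows\<close>

lemma bij_w: "c < r \<Longrightarrow> bij_betw (w c) {..<v} {..<v}"
  using w_inj w_less unfolding bij_betw_def by (intro conjI endo_inj_surj) auto

lemma bij_\<sigma>: "j < v \<Longrightarrow> bij_betw (\<lambda>c. \<sigma> c j) {..<r} {..<r}"
  using \<sigma>_inj \<sigma>_less unfolding bij_betw_def by (intro conjI endo_inj_surj) auto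

text \<open>Separating the digits of \<open>y\<close> leaves a row inner product of \<open>E\<close>
  times a column inner product of \<open>F\<close>.\<close>

lemma sum_E_F:
  assumes "e < q" "e' < q" "l < k" "l' < k"
  shows "(\<Sum>y<v. E $$ (e, y div k) * cnj (F $$ (y mod k, l))
      * cnj (E $$ (e', y div k) * cnj (F $$ (y mod k, l')))) = (if e = e' \<and> l = l' then of_nat v else 0)"
proof -
  have "(\<Sum>y<v. E $$ (e, y div k) * cnj (F $$ (y mod k, l))
      * cnj (E $$ (e', y div k) * cnj (F $$ (y mod k, l'))))
      = (\<Sum>y<v. (E $$ (e, y div k) * cnj (E $$ (e', y div k)))
          * (cnj (F $$ (y mod k, l)) * F $$ (y mod k, l')))"
    by (simp add: mult_ac)
  also have "\<dots> = (\<Sum>x<q. \<Sum>y<k. (E $$ (e, x) * cnj (E $$ (e', x)))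
          * (cnj (F $$ (y, l)) * F $$ (y, l')))"
    by (rule sum_div_mod)
  also have "\<dots> = (\<Sum>x<q. E $$ (e, x) * cnj (E $$ (e', x)))
      * (\<Sum>y<k. cnj (F $$ (y, l)) * F $$ (y, l'))"
    by (rule sum_product[symmetric])
  finally show ?thesis
    using assms by (auto simp: hadamard_row[OF E] hadamard_col[OF F])
qed

text \<open>Both rows lie in the same class, so replacing each vertex by its place in that class, a
  bijection, eliminates the design from the sum.\<close>

lemma sum_phase:
  assumes "a < b" "a' < b" "l < k" "l' < k" "a div q = a' div q"
  shows "(\<Sum>j<v. phase l a j * cnj (phase l' a' j)) = (if a = a' \<and> l = l' then of_nat v else 0)"
proof -
  have c: "a div q < r" using assms by (intro div_less_of_less_mult)
  have "(\<Sum>j<v. phase l a j * cnj (phase l' a' j))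
     = (\<Sum>y<v. E $$ (a mod q, y div k) * cnj (F $$ (y mod k, l))
      * cnj (E $$ (a' mod q, y div k) * cnj (F $$ (y mod k, l'))))"
    unfolding phase_def assms(5)[symmetric]
    by (rule sum.reindex_bij_betw[OF bij_w[OF c]])
  also have "\<dots> = (if a mod q = a' mod q \<and> l = l' then of_nat v else 0)"
    using assms pos by (intro sum_E_F) auto
  finally show ?thesis using assms(5) by (metis div_mult_mod_eq)
qed

text \<open>Over the \<open>r + 1\<close> columns belonging to vertex \<open>j\<close>, the sum is
  the inner product of columns \<open>s j\<close> and \<open>s' j\<close> of \<open>G\<close>. The
  bound \<open>r + 1\<close> on these indices admits the constant choice \<open>r\<close>, which
  describes \<open>rest\<close>.\<close>

lemma sum_G_fibres:
  fixes A A' :: "nat \<Rightarrow> complex"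
  assumes s: "\<And>j. j < v \<Longrightarrow> s j < r + 1" "\<And>j. j < v \<Longrightarrow> s' j < r + 1"
  shows "(\<Sum>x<n. A (x div (r + 1)) * cnj (G $$ (x mod (r + 1), s (x div (r + 1))))
      * cnj (A' (x div (r + 1)) * cnj (G $$ (x mod (r + 1), s' (x div (r + 1))))))
     = of_nat (r + 1) * (\<Sum>j<v. if s j = s' j then A j * cnj (A' j) else 0)"
proof -
  have "(\<Sum>x<n. A (x div (r + 1)) * cnj (G $$ (x mod (r + 1), s (x div (r + 1))))
      * cnj (A' (x div (r + 1)) * cnj (G $$ (x mod (r + 1), s' (x div (r + 1))))))
    = (\<Sum>j<v. \<Sum>m<r + 1. A j * cnj (G $$ (m, s j)) * cnj (A' j * cnj (G $$ (m, s' j))))"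
    by (rule sum_div_mod)
  also have "\<dots> = (\<Sum>j<v. A j * cnj (A' j) * (\<Sum>m<r + 1. cnj (G $$ (m, s j)) * G $$ (m, s' j)))"
    unfolding sum_distrib_left by (intro sum.cong refl) (simp add: mult_ac)
  also have "\<dots> = (\<Sum>j<v. of_nat (r + 1) * (if s j = s' j then A j * cnj (A' j) else 0))"
    using s by (intro sum.cong refl) (simp only: hadamard_col[OF G] lessThan_iff, simp)
  finally show ?thesis by (simp only: sum_distrib_left)
qed

lemma Psi_rows:
  assumes a: "a < b" "a' < b" and l: "l < k" "l' < k"
  shows "(\<Sum>x<n. Psi l $$ (a, x) * cnj (Psi l' $$ (a', x))) = (if a = a' \<and> l = l' then of_nat n else 0)"
proof -
  note c = a[THEN div_less_of_less_mult]
  have "(\<Sum>x<n. Psi l $$ (a, x) * cnj (Psi l' $$ (a', x)))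
    = of_nat (r + 1) * (\<Sum>j<v. if \<sigma> (a div q) j = \<sigma> (a' div q) j
        then phase l a j * cnj (phase l' a' j) else 0)"
    using a \<sigma>_less[OF c(1)] \<sigma>_less[OF c(2)]
    by (subst sum_G_fibres[symmetric]) (auto simp: Psi_def less_Suc_eq)
  \<comment> \<open>For different classes the ranks differ at every vertex, so no term survives; for
    equal classes every term does.\<close>
  also have "\<dots> = of_nat (r + 1) * (if a div q = a' div q
      then \<Sum>j<v. phase l a j * cnj (phase l' a' j) else 0)"
    using c \<sigma>_inj by (auto simp: inj_on_def intro!: sum.neutral)
  also have "\<dots> = (if a = a' \<and> l = l' then of_nat n else 0)"
    using sum_phase[OF a l] by (auto simp: algebra_simps)
  finally show ?thesis .
qed

text \<open>The columns of \<open>G\<close> used by \<open>Psi\<close> have index below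
  \<open>r\<close>, while \<open>rest\<close> uses column \<open>r\<close>, so the two are
  orthogonal at every vertex.\<close>

lemma Psi_rest_rows:
  assumes a: "a < b" "a' < v"
  shows "(\<Sum>x<n. Psi l $$ (a, x) * cnj (rest $$ (a', x))) = 0"
proof -
  note c = a(1)[THEN div_less_of_less_mult]
  have "(\<Sum>x<n. Psi l $$ (a, x) * cnj (rest $$ (a', x)))
    = of_nat (r + 1) * (\<Sum>j<v. if \<sigma> (a div q) j = r
        then phase l a j * cnj (E $$ (a' div k, j div k) * F $$ (a' mod k, j mod k)) else 0)"
    using a \<sigma>_less[OF c]
    by (subst sum_G_fibres[symmetric]) (auto simp: Psi_def rest_def less_Suc_eq)
  also have "\<dots> = 0"
    using \<sigma>_less[OF c] by (intro mult_eq_0_iff[THEN iffD2] disjI2 sum.neutral) fastforce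
  finally show ?thesis .
qed

lemma rest_rows:
  assumes a: "a < v" "a' < v"
  shows "(\<Sum>x<n. rest $$ (a, x) * cnj (rest $$ (a', x))) = (if a = a' then of_nat n else 0)"
proof -
  note EF = complex_hadamard_kron[OF E F]
  note ent = kron_entry[OF hadamard_carrier[OF E] hadamard_carrier[OF F]]
  \<comment> \<open>Here both column choices are constantly \<open>r\<close>. The trivial condition
    \<open>r = r\<close> puts the sum in the form of \<open>sum_G_fibres\<close>, leaving an inner
    product of rows of the Kronecker product.\<close>
  have "(\<Sum>x<n. rest $$ (a, x) * cnj (rest $$ (a', x)))
    = of_nat (r + 1) * (\<Sum>j<v. if r = r
        then (E \<otimes>\<^sub>k F) $$ (a, j) * cnj ((E \<otimes>\<^sub>k F) $$ (a', j)) else 0)"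
    using a div_less_of_less_mult[of _ v "r + 1"]
    by (subst sum_G_fibres[symmetric]) (auto simp: rest_def ent intro!: sum.cong)
  then show ?thesis
    using hadamard_row[OF EF a] by (simp add: algebra_simps)
qed

section \<open>The square Hadamard matrix containing all rows\<close>

definition stack :: "complex mat" where
  "stack = foldr (@\<^sub>r) (map Psi [0..<k]) rest"

lemma stack_size: "k * b + v = n"
  by (simp add: algebra_simps)

lemma set_Psi: "set (map Psi ls) \<subseteq> carrier_mat b n"
  using Psi_carrier by auto

lemma stack_carrier: "stack \<in> carrier_mat n n"
  using foldr_append_rows_carrier[OF set_Psi rest_carrier, of "[0..<k]"] stack_size
  unfolding stack_def by simp

lemma stack_entry:
  assumes "i < n" "x < n"
  shows "stack $$ (i, x) = (if i < k * b then Psi (i div b) $$ (i mod b, x) else rest $$ (i - k * b, x))"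
  using foldr_append_rows_entry[OF set_Psi rest_carrier, of i "[0..<k]" x] assms stack_size
    div_less_of_less_mult[of i k b]
  unfolding stack_def by (auto split: if_splits)

lemma Psi_cmod:
  assumes "a < b" "x < n" "l < k"
  shows "cmod (Psi l $$ (a, x)) = 1"
proof -
  have "a div q < r" "a mod q < q" "x div (r + 1) < v" "x mod (r + 1) < r + 1"
    using assms pos by (auto intro: div_less_of_less_mult)
  moreover from this have "w (a div q) (x div (r + 1)) div k < q" "w (a div q) (x div (r + 1)) mod k < k"
    "\<sigma> (a div q) (x div (r + 1)) < r + 1"
    using w_less \<sigma>_less pos by (auto intro!: div_less_of_less_mult less_SucI)
  ultimately show ?thesis
    using assms by (simp add: Psi_def phase_def norm_mult hadamard_cmod[OF E] hadamard_cmod[OF F]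
        hadamard_cmod[OF G])
qed

lemma rest_cmod:
  assumes "a < v" "x < n"
  shows "cmod (rest $$ (a, x)) = 1"
proof -
  have "a div k < q" "a mod k < k" "x div (r + 1) < v" "x mod (r + 1) < r + 1"
    using assms pos by (auto intro: div_less_of_less_mult)
  moreover from this have "x div (r + 1) div k < q" "x div (r + 1) mod k < k"
    using pos by (auto intro!: div_less_of_less_mult)
  ultimately show ?thesis
    using assms by (simp add: rest_def norm_mult hadamard_cmod[OF E] hadamard_cmod[OF F]
        hadamard_cmod[OF G])
qed

text \<open>An index below \<open>k * b\<close> encodes the pair of \<open>l\<close> and a row of
  \<open>Psi l\<close>; the others number the rows of \<open>rest\<close>. The row relations cover
  all combinations, once the mixed one is also available in conjugated order.\<close>

lemma hadamard_stack: "complex_hadamard n stack"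
proof (rule hadamardI[OF stack_carrier])
  have div_b: "i div b < k" "i mod b < b" if "i < k * b" for i
    using that pos by (auto intro: div_less_of_less_mult)
  have diff: "i - k * b < v" if "i < n" "\<not> i < k * b" for i
    using that stack_size by linarith
  fix i j assume ij: "i < n" "j < n"
  show "cmod (stack $$ (i, j)) = 1"
    using ij div_b[of i] diff[of i] by (auto simp: stack_entry Psi_cmod rest_cmod)
  have "(\<Sum>x<n. rest $$ (a, x) * cnj (Psi l $$ (a', x))) = 0" if "a < v" "a' < b" for a a' l
  proof -
    have "(\<Sum>x<n. rest $$ (a, x) * cnj (Psi l $$ (a', x)))
        = cnj (\<Sum>x<n. Psi l $$ (a', x) * cnj (rest $$ (a, x)))"
      by (simp add: mult.commute)
    then show ?thesis unfolding Psi_rest_rows[OF that(2,1), of l] by simp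
  qed
  note rest_Psi_rows = this
  have split: "i = j \<longleftrightarrow> i mod b = j mod b \<and> i div b = j div b"
    by (metis div_mult_mod_eq)
  have sum_eq: "(\<Sum>x<n. stack $$ (i, x) * cnj (stack $$ (j, x))) =
    (\<Sum>x<n. (if i < k * b then Psi (i div b) $$ (i mod b, x) else rest $$ (i - k * b, x))
       * cnj (if j < k * b then Psi (j div b) $$ (j mod b, x) else rest $$ (j - k * b, x)))"
    using ij by (intro sum.cong refl) (simp add: stack_entry)
  show "(\<Sum>x<n. stack $$ (i, x) * cnj (stack $$ (j, x))) = (if i = j then of_nat n else 0)"
  proof (cases "i < k * b"; cases "j < k * b")
    assume "i < k * b" "j < k * b"
    then show ?thesis
      unfolding sum_eq split
      using Psi_rows[of "i mod b" "j mod b" "i div b" "j div b"] div_b[of i] div_b[of j] by presburger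
  next
    assume "i < k * b" "\<not> j < k * b"
    then show ?thesis
      unfolding sum_eq using Psi_rest_rows[OF div_b(2) diff] ij by auto
  next
    assume "\<not> i < k * b" "j < k * b"
    then show ?thesis
      unfolding sum_eq using rest_Psi_rows[OF diff div_b(2)] ij by auto
  next
    assume ge: "\<not> i < k * b" "\<not> j < k * b"
    then have "i - k * b = j - k * b \<longleftrightarrow> i = j" by linarith
    with ge show ?thesis
      unfolding sum_eq using rest_rows[OF diff diff, of i j] ij by presburger
  qed
qed

section \<open>Inner products of columns\<close>

lemma Psi_col_inner:
  assumes x: "x < n" "y < n" and l: "l < k"
  shows "col (Psi l) x \<bullet>c col (Psi l) y = of_nat q *
    (\<Sum>c<r. if w c (x div (r + 1)) div k = w c (y div (r + 1)) div k then
       cnj (F $$ (w c (x div (r + 1)) mod k, l)) * F $$ (w c (y div (r + 1)) mod k, l)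
       * (cnj (G $$ (x mod (r + 1), \<sigma> c (x div (r + 1)))) * G $$ (y mod (r + 1), \<sigma> c (y div (r + 1))))
     else 0)"
proof -
  define j j' m m' where jm: "j = x div (r + 1)" "j' = y div (r + 1)" "m = x mod (r + 1)" "m' = y mod (r + 1)"
  have j: "j < v" "j' < v"
    using x unfolding jm by (auto intro: div_less_of_less_mult)
  let ?f = "\<lambda>c. cnj (F $$ (w c j mod k, l)) * F $$ (w c j' mod k, l)
     * (cnj (G $$ (m, \<sigma> c j)) * G $$ (m', \<sigma> c j'))"
  have "col (Psi l) x \<bullet>c col (Psi l) y = (\<Sum>a<b. Psi l $$ (a, x) * cnj (Psi l $$ (a, y)))"
    by (rule col_inner_entries[OF Psi_carrier x])
  also have "\<dots> = (\<Sum>a<b. E $$ (a mod q, w (a div q) j div k) * cnj (F $$ (w (a div q) j mod k, l))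
      * cnj (G $$ (m, \<sigma> (a div q) j)) * cnj (E $$ (a mod q, w (a div q) j' div k)
      * cnj (F $$ (w (a div q) j' mod k, l)) * cnj (G $$ (m', \<sigma> (a div q) j'))))"
    using x by (intro sum.cong refl) (simp add: Psi_def phase_def jm)
  also have "\<dots> = (\<Sum>c<r. \<Sum>e<q. E $$ (e, w c j div k) * cnj (F $$ (w c j mod k, l))
      * cnj (G $$ (m, \<sigma> c j)) * cnj (E $$ (e, w c j' div k)
      * cnj (F $$ (w c j' mod k, l)) * cnj (G $$ (m', \<sigma> c j'))))"
    by (rule sum_div_mod)
  \<comment> \<open>Within a class only the factors from \<open>E\<close> vary with
    \<open>e\<close>. Their sum is a column inner product, nonzero exactly when the two vertices lie
    in the same block of that class.\<close>
  also have "\<dots> = (\<Sum>c<r. (\<Sum>e<q. cnj (E $$ (e, w c j' div k)) * E $$ (e, w c j div k)) * ?f c)"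
    unfolding sum_distrib_right by (intro sum.cong refl) (simp add: mult_ac)
  also have "\<dots> = (\<Sum>c<r. (if w c j' div k = w c j div k then of_nat q else 0) * ?f c)"
    using w_less j by (intro sum.cong refl arg_cong2[of _ _ _ _ "(*)"] hadamard_col[OF E])
      (auto intro!: div_less_of_less_mult)
  also have "\<dots> = of_nat q * (\<Sum>c<r. if w c j div k = w c j' div k then ?f c else 0)"
    unfolding sum_distrib_left by (intro sum.cong refl) auto
  finally show ?thesis unfolding jm .
qed

text \<open>A vertex shares a block with itself in every class, and the factors from
  \<open>F\<close> cancel. As \<open>c\<close> varies, the rank runs through all columns of
  \<open>G\<close> but the last.\<close>

lemma Psi_col_same_vertex:
  assumes x: "x < n" "y < n" and l: "l < k" and same: "x div (r + 1) = y div (r + 1)"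
  shows "col (Psi l) x \<bullet>c col (Psi l) y = of_nat q *
    ((if x = y then of_nat (r + 1) else 0) - cnj (G $$ (x mod (r + 1), r)) * G $$ (y mod (r + 1), r))"
proof -
  define j m m' where jm: "j = x div (r + 1)" "m = x mod (r + 1)" "m' = y mod (r + 1)"
  have j: "j < v" and m: "m < r + 1" "m' < r + 1"
    using x unfolding jm by (auto intro: div_less_of_less_mult)
  have eq: "m' = m \<longleftrightarrow> x = y"
    using same unfolding jm by (metis div_mult_mod_eq)
  have "col (Psi l) x \<bullet>c col (Psi l) y = of_nat q * (\<Sum>c<r.
       cnj (F $$ (w c j mod k, l)) * F $$ (w c j mod k, l)
       * (cnj (G $$ (m, \<sigma> c j)) * G $$ (m', \<sigma> c j)))"
    unfolding Psi_col_inner[OF x l] same[symmetric] jm by simp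
  also have "(\<Sum>c<r. cnj (F $$ (w c j mod k, l)) * F $$ (w c j mod k, l)
       * (cnj (G $$ (m, \<sigma> c j)) * G $$ (m', \<sigma> c j))) = (\<Sum>c<r. cnj (G $$ (m, \<sigma> c j)) * G $$ (m', \<sigma> c j))"
    using pos l by (intro sum.cong refl) (simp add: hadamard_mult_cnj[OF F])
  also have "\<dots> = (\<Sum>s<r. cnj (G $$ (m, s)) * G $$ (m', s))"
    by (rule sum.reindex_bij_betw[OF bij_\<sigma>[OF j]])
  \<comment> \<open>Adding and subtracting the term of the missing column \<open>r\<close> makes the
    row orthogonality of \<open>G\<close> applicable.\<close>
  also have "\<dots> = (\<Sum>s<r + 1. G $$ (m', s) * cnj (G $$ (m, s))) - cnj (G $$ (m, r)) * G $$ (m', r)"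
    by (simp add: mult.commute)
  also have "(\<Sum>s<r + 1. G $$ (m', s) * cnj (G $$ (m, s))) = (if x = y then of_nat (r + 1) else 0)"
    unfolding hadamard_row[OF G m(2,1)] eq ..
  finally show ?thesis unfolding jm .
qed

text \<open>The value is \<open>q * ((r + 1) - 1) = q * r = b\<close>.\<close>

lemma Psi_col_norm:
  assumes "x < n" "l < k"
  shows "col (Psi l) x \<bullet>c col (Psi l) x = complex_of_real (real b)"
proof -
  have "cnj (G $$ (x mod (r + 1), r)) * G $$ (x mod (r + 1), r) = 1"
    by (rule hadamard_mult_cnj[OF G]) auto
  then show ?thesis
    unfolding Psi_col_same_vertex[OF assms(1) assms(1) assms(2) refl] by simp
qed

text \<open>For a common vertex only the subtracted unimodular term remains; for distinct vertices
  only the one class joining them contributes, again unimodularly. Either way the factor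
  \<open>q\<close> is the modulus.\<close>

lemma Psi_col_angle:
  assumes x: "x < n" "y < n" and l: "l < k" and ne: "x \<noteq> y"
  shows "cmod (col (Psi l) x \<bullet>c col (Psi l) y) = real q"
proof (cases "x div (r + 1) = y div (r + 1)")
  case True
  have "x mod (r + 1) < r + 1" "y mod (r + 1) < r + 1" by auto
  then show ?thesis
    unfolding Psi_col_same_vertex[OF x l True] using ne
    by (simp add: norm_mult hadamard_cmod[OF G])
next
  case False
  define j j' m m' where jm: "j = x div (r + 1)" "j' = y div (r + 1)" "m = x mod (r + 1)" "m' = y mod (r + 1)"
  have j: "j < v" "j' < v" and m: "m < r + 1" "m' < r + 1"
    using x unfolding jm by (auto intro: div_less_of_less_mult)
  let ?f = "\<lambda>c. cnj (F $$ (w c j mod k, l)) * F $$ (w c j' mod k, l)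
     * (cnj (G $$ (m, \<sigma> c j)) * G $$ (m', \<sigma> c j'))"
  obtain c where c: "c < r" and c_iff: "\<And>c'. c' < r \<Longrightarrow> w c' j div k = w c' j' div k \<longleftrightarrow> c' = c"
    using joined_once[OF j] False unfolding jm by metis
  have "(\<Sum>c<r. if w c j div k = w c j' div k then ?f c else 0) = (\<Sum>c'<r. if c' = c then ?f c' else 0)"
    using c_iff by (intro sum.cong) auto
  also have "\<dots> = ?f c" using c by simp
  finally have "col (Psi l) x \<bullet>c col (Psi l) y = of_nat q * ?f c"
    unfolding Psi_col_inner[OF x l] jm by simp
  moreover have "\<sigma> c j < r + 1" "\<sigma> c j' < r + 1"
    using \<sigma>_less[OF c] j by (auto intro: less_SucI)
  ultimately show ?thesis
    using l m pos by (simp add: norm_mult hadamard_cmod[OF F] hadamard_cmod[OF G])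
qed

section \<open>The frame, its complement and the row spaces\<close>

lemma Psi_mult_adjoint:
  assumes "l < k"
  shows "Psi l * mat_adjoint (Psi l) = complex_of_real (real n) \<cdot>\<^sub>m 1\<^sub>m b"
proof (rule eq_matI)
  fix a a' assume "a < dim_row (complex_of_real (real n) \<cdot>\<^sub>m 1\<^sub>m b)"
    "a' < dim_col (complex_of_real (real n) \<cdot>\<^sub>m 1\<^sub>m b)"
  then have a: "a < b" "a' < b" by auto
  show "(Psi l * mat_adjoint (Psi l)) $$ (a, a') = (complex_of_real (real n) \<cdot>\<^sub>m 1\<^sub>m b) $$ (a, a')"
    unfolding times_adjoint_entry[OF Psi_carrier Psi_carrier a] Psi_rows[OF a assms assms]
    using a by simp
qed (use Psi_carrier[of l] adjoint_carrier[OF Psi_carrier] in auto)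

lemma etf_Psi:
  assumes "l < k" "mat_over K b n (Psi l)"
  shows "etf K b n (Psi l)"
  unfolding etf_def
proof (intro conjI)
  show "\<exists>\<beta> \<gamma> \<alpha>. \<beta> > 0 \<and> \<gamma> \<ge> 0 \<and> \<alpha> > 0
      \<and> (\<forall>j<n. col (Psi l) j \<bullet>c col (Psi l) j = complex_of_real \<beta>)
      \<and> (\<forall>j<n. \<forall>j'<n. j \<noteq> j' \<longrightarrow> cmod (col (Psi l) j \<bullet>c col (Psi l) j') = \<gamma>)
      \<and> Psi l * mat_adjoint (Psi l) = complex_of_real \<alpha> \<cdot>\<^sub>m 1\<^sub>m b"
  \<comment> \<open>The squared norm is \<open>b\<close>, the common modulus of inner products is
    \<open>q\<close>, and the frame constant is the squared row norm \<open>n\<close>.\<close>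
  proof (rule exI[of _ "real b"], rule exI[of _ "real q"], rule exI[of _ "real n"], intro conjI)
    have "n > 0" using pos by simp
    then show "real n > 0" by (simp only: of_nat_0_less_iff)
    show "real b > 0" "real q \<ge> 0" using pos by simp_all
  qed (use assms(1) Psi_col_norm Psi_col_angle Psi_mult_adjoint in blast)+
qed (rule assms(2))

lemma flat_Psi: "l < k \<Longrightarrow> flat_mat (Psi l)"
  unfolding flat_mat_def using Psi_cmod Psi_carrier[of l] by fastforce

definition compl :: "complex mat" where
  "compl = foldr (@\<^sub>r) (map Psi [1..<k]) rest"

lemma stack_eq_append: "stack = Psi 0 @\<^sub>r compl"
  using pos unfolding stack_def compl_def by (simp add: upt_conv_Cons)

lemma b_less_n: "b < n"
proof -
  have "b < q * (r + 1)" using pos by simp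
  also have "\<dots> \<le> q * (r + 1) * k" using pos by simp
  finally show ?thesis by (simp add: mult_ac)
qed

lemma compl_carrier: "compl \<in> carrier_mat (n - b) n"
proof -
  have "compl \<in> carrier_mat ((k - 1) * b + v) n"
    using foldr_append_rows_carrier[OF set_Psi rest_carrier, of "[1..<k]"]
    unfolding compl_def by simp
  moreover have "(k - 1) * b + b = k * b"
    using pos by (cases k) auto
  then have "(k - 1) * b + v = n - b"
    using stack_size by linarith
  ultimately show ?thesis by simp
qed

lemma stack_entry_append:
  assumes "x < n"
  shows "a < b \<Longrightarrow> stack $$ (a, x) = Psi 0 $$ (a, x)"
    and "i < n - b \<Longrightarrow> stack $$ (b + i, x) = compl $$ (i, x)"
  using append_rows_entry[OF Psi_carrier compl_carrier _ assms] b_less_n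
  unfolding stack_eq_append by auto

text \<open>Lets the complement inherit both flatness and real entries from the full stack.\<close>

lemma elements_compl: "elements_mat compl \<subseteq> elements_mat stack"
proof
  fix z assume "z \<in> elements_mat compl"
  then obtain i x where ix: "i < n - b" "x < n" "z = compl $$ (i, x)"
    using compl_carrier by (rule elements_matE)
  then show "z \<in> elements_mat stack"
    using stack_entry_append(2)[OF ix(2,1)] by (intro elements_matI[OF stack_carrier, of "b + i" x]) auto
qed

lemma flat_compl: "flat_mat compl"
  using elements_compl hadamard_stack unfolding complex_hadamard_def flat_mat_def by blast

lemma Psi_submatrix: "Psi 0 = submatrix stack {..<b} UNIV"
proof -
  have dims: "{i. i < dim_row stack \<and> i \<in> {..<b}} = {..<b}" "{j. j < dim_col stack \<and> j \<in> UNIV} = {..<n}"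
    using stack_carrier b_less_n by auto
  \<comment> \<open>\<open>submatrix\<close> enumerates a set of rows increasingly; on an initial
    segment that enumeration is the identity.\<close>
  have pick: "pick {..<b} a = a" if "a < b" for a
  proof -
    have "{x \<in> {..<b}. x < a} = {..<a}" using that by auto
    then show ?thesis using pick_card_in_set[of a "{..<b}"] that by simp
  qed
  show ?thesis
    using Psi_carrier[of 0] dims
    by (intro eq_matI)
      (auto simp: submatrix_def pick pick_UNIV stack_entry_append(1) simp del: mult_Suc_right add_Suc_right)
qed

lemma complex_hadamard_etf_Psi: "complex_hadamard_etf b n (Psi 0)"
  unfolding complex_hadamard_etf_def
  using etf_Psi[of 0 UNIV] Psi_carrier[of 0] pos hadamard_stack Psi_submatrix
  by (auto simp: mat_over_def simp del: mult_Suc_right)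

text \<open>Expanding two linear combinations of rows leaves only inner products of rows with
  different \<open>l\<close>, all of which vanish.\<close>

lemma orthogonal_row_spaces:
  assumes l: "l < k" "m < k" and ne: "l \<noteq> m"
  shows "orthogonal_sets (row_space_over K (Psi l)) (row_space_over K (Psi m))"
  unfolding orthogonal_sets_def row_space_over_def
proof (safe)
  fix s t :: "complex vec"
  assume st: "s \<in> carrier_vec (dim_row (Psi l))" "t \<in> carrier_vec (dim_row (Psi m))"
  have entry: "(transpose_mat (Psi i) *\<^sub>v u) $ x = (\<Sum>a<b. Psi i $$ (a, x) * u $ a)"
    if "u \<in> carrier_vec (dim_row (Psi i))" "x < n" for i u x
    using that Psi_carrier[of i] by (auto simp: scalar_prod_def lessThan_atLeast0 intro!: sum.cong)
  have "(transpose_mat (Psi l) *\<^sub>v s) \<bullet>c (transpose_mat (Psi m) *\<^sub>v t)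
     = (\<Sum>x<n. (transpose_mat (Psi l) *\<^sub>v s) $ x * cnj ((transpose_mat (Psi m) *\<^sub>v t) $ x))"
    using st Psi_carrier[of l] Psi_carrier[of m]
    by (auto simp: scalar_prod_def lessThan_atLeast0 simp del: index_mult_mat_vec intro!: sum.cong)
  also have "\<dots> = (\<Sum>x<n. \<Sum>a<b. \<Sum>a'<b. s $ a * cnj (t $ a') * (Psi l $$ (a, x) * cnj (Psi m $$ (a', x))))"
    using st by (intro sum.cong refl) (simp add: entry sum_product mult_ac)
  also have "\<dots> = (\<Sum>a<b. \<Sum>a'<b. s $ a * cnj (t $ a') * (\<Sum>x<n. Psi l $$ (a, x) * cnj (Psi m $$ (a', x))))"
    unfolding sum_distrib_left
    by (subst sum.swap, rule sum.cong[OF refl], rule sum.swap)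
  also have "\<dots> = 0"
    using Psi_rows[OF _ _ l] ne by (intro sum.neutral ballI) simp
  finally show "(transpose_mat (Psi l) *\<^sub>v s) \<bullet>c (transpose_mat (Psi m) *\<^sub>v t) = 0" .
qed

section \<open>Real scalars\<close>

definition scalars_real :: bool where
  "scalars_real \<longleftrightarrow> elements_mat E \<subseteq> \<real> \<and> elements_mat F \<subseteq> \<real> \<and> elements_mat G \<subseteq> \<real>"

context
  assumes real: scalars_real
begin

lemma E_F_G_real:
  "i < q \<Longrightarrow> j < q \<Longrightarrow> E $$ (i, j) \<in> \<real>"
  "i < k \<Longrightarrow> j < k \<Longrightarrow> F $$ (i, j) \<in> \<real>"
  "i < r + 1 \<Longrightarrow> j < r + 1 \<Longrightarrow> G $$ (i, j) \<in> \<real>"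
  using real elements_matI[OF hadamard_carrier[OF E], of i j]
    elements_matI[OF hadamard_carrier[OF F], of i j] elements_matI[OF hadamard_carrier[OF G], of i j]
  unfolding scalars_real_def by blast+

lemma Psi_real:
  assumes "a < b" "x < n" "l < k"
  shows "Psi l $$ (a, x) \<in> \<real>"
proof -
  have "a div q < r" "a mod q < q" "x div (r + 1) < v" "x mod (r + 1) < r + 1"
    using assms pos by (auto intro: div_less_of_less_mult)
  moreover from this have "w (a div q) (x div (r + 1)) div k < q" "w (a div q) (x div (r + 1)) mod k < k"
    "\<sigma> (a div q) (x div (r + 1)) < r + 1"
    using w_less \<sigma>_less pos by (auto intro!: div_less_of_less_mult less_SucI)
  ultimately show ?thesis
    using assms pos by (auto simp: Psi_def phase_def intro!: Reals_mult cnj_in_Reals E_F_G_real)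
qed

lemma rest_real:
  assumes "a < v" "x < n"
  shows "rest $$ (a, x) \<in> \<real>"
proof -
  have "a div k < q" "a mod k < k" "x div (r + 1) < v" "x mod (r + 1) < r + 1"
    using assms pos by (auto intro: div_less_of_less_mult)
  moreover from this have "x div (r + 1) div k < q" "x div (r + 1) mod k < k"
    using pos by (auto intro!: div_less_of_less_mult)
  ultimately show ?thesis
    using assms pos by (auto simp: rest_def intro!: Reals_mult cnj_in_Reals E_F_G_real)
qed

lemma elements_Psi_real:
  assumes "l < k"
  shows "elements_mat (Psi l) \<subseteq> \<real>"
proof
  fix z assume "z \<in> elements_mat (Psi l)"
  then obtain a x where "a < b" "x < n" "z = Psi l $$ (a, x)"
    using Psi_carrier by (rule elements_matE)
  then show "z \<in> \<real>" using Psi_real assms by blast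
qed

lemma elements_stack_real: "elements_mat stack \<subseteq> \<real>"
proof
  fix z assume "z \<in> elements_mat stack"
  then obtain i x where ix: "i < n" "x < n" "z = stack $$ (i, x)"
    using stack_carrier by (rule elements_matE)
  show "z \<in> \<real>"
  proof (cases "i < k * b")
    case True
    have "i div b < k" "i mod b < b" using True pos by (auto intro: div_less_of_less_mult)
    then show ?thesis using True ix Psi_real by (simp add: stack_entry)
  next
    case False
    then have "i - k * b < v" using ix stack_size by linarith
    then show ?thesis using False ix rest_real by (simp add: stack_entry)
  qed
qed

lemma real_hadamard_etf_Psi: "real_hadamard_etf b n (Psi 0)"
proof -
  have "etf \<real> b n (Psi 0)"
    using etf_Psi[of 0 \<real>] Psi_carrier[of 0] pos elements_Psi_real unfolding mat_over_def by blast
  moreover have "real_hadamard n stack"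
    by (rule real_hadamardI[OF hadamard_stack elements_stack_real])
  ultimately show ?thesis
    unfolding real_hadamard_etf_def using Psi_submatrix by blast
qed

end

section \<open>Conclusions over the chosen field\<close>

lemma mat_over_scalars:
  assumes "K = (if scalars_real then \<real> else UNIV)"
  shows "l < k \<Longrightarrow> mat_over K b n (Psi l)" "mat_over K (n - b) n compl"
  using assms Psi_carrier[of l] compl_carrier elements_Psi_real elements_compl elements_stack_real
  unfolding mat_over_def by (auto split: if_splits)

lemma naimark_complement_compl:
  assumes "K = (if scalars_real then \<real> else UNIV)"
  shows "naimark_complement K b n (Psi 0) compl"
proof -
  have "n > 0" using b_less_n by linarith
  from complex_hadamard_unitary[OF hadamard_stack this]
  have "unitary_mat n (complex_of_real (real n powr (-1/2)) \<cdot>\<^sub>m (Psi 0 @\<^sub>r compl))"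
    unfolding stack_eq_append .
  moreover have "etf K b n (Psi 0)"
    using etf_Psi mat_over_scalars(1)[OF assms] pos by blast
  moreover have "Psi 0 * mat_adjoint (Psi 0) = complex_of_real (real n) \<cdot>\<^sub>m 1\<^sub>m b"
    using Psi_mult_adjoint pos by blast
  moreover have "real n > 0" using \<open>n > 0\<close> by (simp only: of_nat_0_less_iff)
  ultimately show ?thesis
    unfolding naimark_complement_def using b_less_n mat_over_scalars(2)[OF assms] by blast
qed

lemma conclusions:
  assumes K: "K = (if elements_mat E \<subseteq> \<real> \<and> elements_mat F \<subseteq> \<real> \<and> elements_mat G \<subseteq> \<real> then \<real> else UNIV)"
  shows "(\<forall>l<k. etf K b n (Psi l) \<and> flat_mat (Psi l))
    \<and> (\<forall>l<k. \<forall>m<k. l \<noteq> m \<longrightarrow> orthogonal_sets (row_space_over K (Psi l)) (row_space_over K (Psi m)))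
    \<and> naimark_complement K b n (Psi 0) compl \<and> flat_mat compl
    \<and> (if K = \<real> then real_hadamard_etf b n (Psi 0) else complex_hadamard_etf b n (Psi 0))"
proof -
  have K': "K = (if scalars_real then \<real> else UNIV)"
    using K unfolding scalars_real_def .
  \<comment> \<open>As the two candidate fields differ, the test \<open>K = \<real>\<close> recovers
    whether all three Hadamard matrices are real.\<close>
  have "\<i> \<notin> \<real>"
    by (simp add: complex_is_Real_iff)
  then have "(UNIV :: complex set) \<noteq> \<real>"
    by blast
  then have "if K = \<real> then real_hadamard_etf b n (Psi 0) else complex_hadamard_etf b n (Psi 0)"
    using K' real_hadamard_etf_Psi complex_hadamard_etf_Psi by metis
  then show ?thesis
    using etf_Psi mat_over_scalars[OF K'] flat_Psi orthogonal_row_spaces naimark_complement_compl[OF K']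
      flat_compl by blast
qed

end

section \<open>Resolvable block designs\<close>

text \<open>A class partitions the vertices into \<open>v div k\<close> blocks of size
  \<open>k\<close>, so the division is exact. Adding up the classes counts the blocks, and since
  there is a block there is a class.\<close>

lemma resolution_counts:
  assumes bibd: "bibd V Bs v k 1 r b" and cons: "consecutive_classes V Bs v k r"
  shows "v div k > 0" "r > 0" "v = v div k * k" "b = r * (v div k)"
proof -
  define q where "q = v div k"
  let ?I = "\<lambda>t. {i. i < b \<and> i div q = t}"
  have b: "b > 0" and k: "v > k" "k > 0" and V: "card V = v" and len: "length Bs = b"
    and Bs: "finite V" "\<forall>B\<in>set Bs. B \<subseteq> V \<and> card B = k"
    using bibd unfolding bibd_def by auto
  have blocks: "card (Bs ! i) = k \<and> finite (Bs ! i)" if "i < b" for i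
  proof -
    have "Bs ! i \<in> set Bs" using len that by simp
    then have "Bs ! i \<subseteq> V" "card (Bs ! i) = k" using Bs(2) by blast+
    then show ?thesis using finite_subset Bs(1) by blast
  qed
  have class_less: "i div q < r" if "i < b" for i
    using cons that len unfolding consecutive_classes_def resolution_def q_def by auto
  have cls: "card (?I t) = q" "disjoint_family_on (\<lambda>i. Bs ! i) (?I t)" "(\<Union>i\<in>?I t. Bs ! i) = V" if "t < r" for t
    using cons that len unfolding consecutive_classes_def resolution_def q_def Let_def by auto
  show "r > 0" using class_less[OF b] by simp
  show "v div k > 0" using k by (simp add: div_greater_zero_iff)
  have "v = card (\<Union>i\<in>?I 0. Bs ! i)" using cls(3) \<open>r > 0\<close> V by simp
  also have "\<dots> = (\<Sum>i\<in>?I 0. card (Bs ! i))"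
    using cls(2) \<open>r > 0\<close> blocks by (intro card_UN_disjoint) (auto simp: disjoint_family_on_def)
  also have "\<dots> = (\<Sum>i\<in>?I 0. k)" using blocks by (intro sum.cong) auto
  also have "\<dots> = q * k" using cls(1) \<open>r > 0\<close> by simp
  finally show "v = v div k * k" unfolding q_def .
  have "b = card (\<Union>t<r. ?I t)"
  proof -
    have "(\<Union>t<r. ?I t) = {..<b}" using class_less by auto
    then show ?thesis by simp
  qed
  also have "\<dots> = (\<Sum>t<r. card (?I t))"
    by (intro card_UN_disjoint) auto
  also have "\<dots> = r * q" using cls(1) by simp
  finally show "b = r * (v div k)" unfolding q_def .
qed

locale flag_permutation =
  fixes V :: "'a set" and vs Bs v k r b q p
  assumes q_def: "q = v div k" and bibd: "bibd V Bs v k 1 r b" and cons: "consecutive_classes V Bs v k r"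
    and vs: "distinct vs" "set vs = V"
    and p: "p permutes {..<b * k}"
    and X: "incidence_mat vs Bs = (1\<^sub>m b \<otimes>\<^sub>k ones_mat 1 k)
      * mat (b * k) (b * k) (\<lambda>(i, j). if i = p j then 1 else 0) * (1\<^sub>m v \<otimes>\<^sub>k ones_mat r 1)"
begin

lemma pos: "q > 0" "k > 0" "r > 0"
  using resolution_counts(1,2)[OF bibd cons] bibd unfolding bibd_def q_def by auto

lemma v_eq: "v = q * k" and b_eq: "b = r * q"
  using resolution_counts(3,4)[OF bibd cons] unfolding q_def by blast+

lemma bk: "b * k = v * r"
  unfolding v_eq b_eq by simp

lemma length_vs: "length vs = v"
proof -
  have "card V = v" using bibd unfolding bibd_def by blast
  then show ?thesis using distinct_card[OF vs(1)] vs(2) by simp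
qed

lemma length_Bs: "length Bs = b"
  using bibd unfolding bibd_def by simp

lemma vs_in: "j < v \<Longrightarrow> vs ! j \<in> V"
  using vs length_vs nth_mem by metis

text \<open>The permutation sends the \<open>s\<close>-th flag at vertex \<open>j\<close> to its
  number in the list by blocks: quotient by \<open>k\<close> is the block, remainder the position
  inside it.\<close>

definition flag :: "nat \<Rightarrow> nat \<Rightarrow> nat" where "flag j s = p (j * r + s)"

definition block :: "nat \<Rightarrow> nat \<Rightarrow> nat" where "block j s = flag j s div k"

lemma flag_less: "j < v \<Longrightarrow> s < r \<Longrightarrow> flag j s < b * k"
  using permutes_in_image[OF p, of "j * r + s"] mult_add_less_mult[of j v s r]
  unfolding flag_def bk by simp

lemma flag_inj: "flag j s = flag j' s' \<Longrightarrow> s < r \<Longrightarrow> s' < r \<Longrightarrow> j = j' \<and> s = s'"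
proof -
  assume "flag j s = flag j' s'" and s: "s < r" "s' < r"
  then have "j * r + s = j' * r + s'"
    unfolding flag_def using permutes_inj[OF p] by (simp add: inj_eq)
  then have "(j * r + s) div r = (j' * r + s') div r" "(j * r + s) mod r = (j' * r + s') mod r"
    by simp_all
  then show "j = j' \<and> s = s'" using s by simp
qed

lemma block_less: "j < v \<Longrightarrow> s < r \<Longrightarrow> block j s < b"
  unfolding block_def using flag_less by (auto intro: div_less_of_less_mult)

text \<open>Read entrywise, the factorization of the incidence matrix counts the flags common to
  vertex \<open>j\<close> and block \<open>i\<close>. The count is taken in the complex numbers and
  then compared with 0 or 1.\<close>

lemma card_block_eq:
  assumes i: "i < b" and j: "j < v"
  shows "card {s. s < r \<and> block j s = i} = (if vs ! j \<in> Bs ! i then 1 else 0)"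
proof -
  let ?A = "1\<^sub>m b \<otimes>\<^sub>k ones_mat 1 k :: complex mat"
  let ?P = "mat (b * k) (b * k) (\<lambda>(i, j). if i = p j then 1 else 0) :: complex mat"
  have ones: "ones_mat 1 k \<in> carrier_mat 1 k" "ones_mat r 1 \<in> carrier_mat r 1"
    unfolding ones_mat_def by auto
  have A: "?A \<in> carrier_mat b (b * k)"
    using kron_carrier[OF one_carrier_mat ones(1), of b] by simp
  have AP: "?A * ?P \<in> carrier_mat b (v * r)"
    using A bk by simp
  have AP_entry: "(?A * ?P) $$ (i, j * r + s) = (if block j s = i then 1 else 0)" if s: "s < r" for s
  proof -
    have z: "j * r + s < b * k" using mult_add_less_mult[OF j s] bk by simp
    have "(?A * ?P) $$ (i, j * r + s) = ?A $$ (i, flag j s)"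
      unfolding flag_def by (rule times_permutation_entry[OF A p i z])
    also have "\<dots> = (if block j s = i then 1 else 0)"
      using one_kron_entry[OF ones(1), of i b "flag j s"] i flag_less[OF j s] pos
      unfolding block_def by (auto simp: ones_mat_def)
    finally show ?thesis .
  qed
  have "(if vs ! j \<in> Bs ! i then 1 else 0 :: complex) = incidence_mat vs Bs $$ (i, j)"
    using i j length_vs length_Bs unfolding incidence_mat_def by simp
  also have "\<dots> = (\<Sum>s<r. (?A * ?P) $$ (i, j * r + s) * ones_mat r 1 $$ (s, 0))"
    using times_one_kron_entry[OF AP ones(2) i, of j] j unfolding X[symmetric] by simp
  also have "\<dots> = (\<Sum>s<r. if block j s = i then 1 else 0)"
    by (intro sum.cong refl) (simp only: AP_entry lessThan_iff, simp add: ones_mat_def)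
  also have "\<dots> = of_nat (card {s. s < r \<and> block j s = i})"
    by (simp add: sum.If_cases Int_def)
  finally show ?thesis
    by (cases "vs ! j \<in> Bs ! i") (simp_all only: if_True if_False of_nat_1_eq_iff of_nat_0_eq_iff)
qed

lemma block_iff:
  assumes "i < b" "j < v"
  shows "vs ! j \<in> Bs ! i \<longleftrightarrow> (\<exists>s<r. block j s = i)"
proof -
  have "finite {s. s < r \<and> block j s = i}" by simp
  then show ?thesis
    using card_block_eq[OF assms] card_gt_0_iff[of "{s. s < r \<and> block j s = i}"]
    by (auto split: if_splits)
qed

text \<open>Two ranks leading to one block would give an incidence entry of at least 2.\<close>

lemma block_inj:
  assumes "j < v" "s < r" "s' < r" "block j s = block j s'"
  shows "s = s'"
proof -
  let ?S = "{t. t < r \<and> block j t = block j s}"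
  have "card ?S \<le> Suc 0"
    unfolding card_block_eq[OF block_less[OF assms(1,2)] assms(1)] by simp
  moreover have "finite ?S" by simp
  ultimately have "\<forall>t\<in>?S. \<forall>t'\<in>?S. t = t'"
    using card_le_Suc0_iff_eq by blast
  moreover have "s \<in> ?S" "s' \<in> ?S" using assms by simp_all
  ultimately show ?thesis by blast
qed

lemma class_props:
  assumes "t < r"
  shows "(\<Union>i\<in>{i. i < b \<and> i div q = t}. Bs ! i) = V"
    and "i < b \<Longrightarrow> i' < b \<Longrightarrow> i div q = t \<Longrightarrow> i' div q = t \<Longrightarrow> x \<in> Bs ! i \<Longrightarrow> x \<in> Bs ! i' \<Longrightarrow> i = i'"
  using cons assms length_Bs
  unfolding consecutive_classes_def resolution_def Let_def q_def disjoint_family_on_def by blast+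

text \<open>Existence holds because the class covers the vertex set. Uniqueness of the block comes
  from disjointness, and of its rank from \<open>block_inj\<close>.\<close>

lemma ex1_in_class:
  assumes c: "c < r" and j: "j < v"
  shows "\<exists>!s. s < r \<and> block j s div q = c"
proof -
  obtain i where "i < b" "i div q = c" "vs ! j \<in> Bs ! i"
    using class_props(1)[OF c] vs_in[OF j] by blast
  then have "\<exists>s. s < r \<and> block j s div q = c"
    using block_iff j by blast
  moreover have "s = s'" if "s < r \<and> block j s div q = c" "s' < r \<and> block j s' div q = c" for s s'
  proof -
    have "block j s < b" "block j s' < b" using block_less j that by auto
    moreover from this have "vs ! j \<in> Bs ! block j s" "vs ! j \<in> Bs ! block j s'"
      using block_iff j that by blast+
    ultimately have "block j s = block j s'"
      using class_props(2)[OF c] that by blast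
    then show ?thesis using block_inj[OF j] that by blast
  qed
  ultimately show ?thesis by blast
qed

definition \<sigma> :: "nat \<Rightarrow> nat \<Rightarrow> nat" where
  "\<sigma> c j = (THE s. s < r \<and> block j s div q = c)"

text \<open>Classes are consecutive, so the flags of class \<open>c\<close> occupy the
  \<open>q * k\<close> numbers from \<open>c * (q * k)\<close> on; the remainder is the offset
  within the class.\<close>

definition w :: "nat \<Rightarrow> nat \<Rightarrow> nat" where
  "w c j = flag j (\<sigma> c j) mod (q * k)"

lemma \<sigma>:
  assumes "c < r" "j < v"
  shows "\<sigma> c j < r" "block j (\<sigma> c j) div q = c"
  using theI'[OF ex1_in_class[OF assms]] unfolding \<sigma>_def by auto

lemma \<sigma>_iff:
  assumes "c < r" "j < v" "s < r"
  shows "block j s div q = c \<longleftrightarrow> s = \<sigma> c j"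
  using ex1_in_class[OF assms(1,2)] \<sigma>[OF assms(1,2)] assms(3) by blast

lemma w_div: "w c j div k = block j (\<sigma> c j) mod q"
  unfolding w_def block_def by (rule mod_mult_div_mod)

lemma w_mod: "w c j mod k = flag j (\<sigma> c j) mod k"
  unfolding w_def by (rule mod_mult_div_mod)

lemma joined_once:
  assumes j: "j < v" "j' < v" and ne: "j \<noteq> j'"
  shows "\<exists>!c. c < r \<and> w c j div k = w c j' div k"
proof -
  have "vs ! j \<noteq> vs ! j'"
    using ne j nth_eq_iff_index_eq[OF vs(1)] unfolding length_vs by blast
  then have "card {i. i < b \<and> vs ! j \<in> Bs ! i \<and> vs ! j' \<in> Bs ! i} = 1"
    using bibd vs_in j unfolding bibd_def by blast
  then obtain i where "{i. i < b \<and> vs ! j \<in> Bs ! i \<and> vs ! j' \<in> Bs ! i} = {i}"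
    by (rule card_1_singletonE)
  then have i: "i' < b \<and> vs ! j \<in> Bs ! i' \<and> vs ! j' \<in> Bs ! i' \<longleftrightarrow> i' = i" for i'
    by blast
  \<comment> \<open>Both blocks belong to class \<open>c\<close>, so equal numbers within the class
    mean equal blocks.\<close>
  have same: "w c j div k = w c j' div k \<longleftrightarrow> block j (\<sigma> c j) = block j' (\<sigma> c j')" if "c < r" for c
    using div_mult_mod_eq[of "block j (\<sigma> c j)" q, unfolded \<sigma>(2)[OF that j(1)]]
      div_mult_mod_eq[of "block j' (\<sigma> c j')" q, unfolded \<sigma>(2)[OF that j(2)]]
    unfolding w_div by metis
  have iff: "w c j div k = w c j' div k \<longleftrightarrow> c = i div q" if c: "c < r" for c
  proof
    assume "w c j div k = w c j' div k"
    then have eq: "block j (\<sigma> c j) = block j' (\<sigma> c j')" using same c by blast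
    have "block j (\<sigma> c j) < b" by (rule block_less[OF j(1) \<sigma>(1)[OF c j(1)]])
    moreover from this have "vs ! j \<in> Bs ! block j (\<sigma> c j)" "vs ! j' \<in> Bs ! block j (\<sigma> c j)"
      using block_iff[OF _ j(1)] block_iff[OF _ j(2)] \<sigma>(1)[OF c j(1)] \<sigma>(1)[OF c j(2)] eq by auto
    ultimately have "block j (\<sigma> c j) = i" using i by blast
    then show "c = i div q" using \<sigma>(2)[OF c j(1)] by simp
  next
    assume "c = i div q"
    have "i < b" "vs ! j \<in> Bs ! i" "vs ! j' \<in> Bs ! i" using i by auto
    then obtain s s' where "s < r" "block j s = i" "s' < r" "block j' s' = i"
      using block_iff[OF _ j(1)] block_iff[OF _ j(2)] by blast
    moreover from this have "s = \<sigma> c j" "s' = \<sigma> c j'"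
      using \<sigma>_iff[OF c j(1)] \<sigma>_iff[OF c j(2)] \<open>c = i div q\<close> by metis+
    ultimately show "w c j div k = w c j' div k" using same c by simp
  qed
  have "i < b" using i by blast
  then have "i div q < r" unfolding b_eq by (rule div_less_of_less_mult)
  then show ?thesis using iff by blast
qed

text \<open>Class and offset determine the flag, and a flag determines its vertex.\<close>

lemma w_inj:
  assumes c: "c < r"
  shows "inj_on (w c) {..<v}"
proof (rule inj_onI)
  fix j j' assume "j \<in> {..<v}" "j' \<in> {..<v}" and eq: "w c j = w c j'"
  then have j: "j < v" "j' < v" by auto
  have "flag i (\<sigma> c i) = c * (q * k) + w c i" if "i < v" for i
  proof -
    have "flag i (\<sigma> c i) div (q * k) = c"
      using \<sigma>(2)[OF c that] unfolding block_def by (simp add: div_mult2_eq mult.commute[of q])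
    then show ?thesis unfolding w_def by (metis div_mult_mod_eq)
  qed
  then have "flag j (\<sigma> c j) = flag j' (\<sigma> c j')" using eq j by simp
  then show "j = j'" using flag_inj \<sigma>(1) c j by blast
qed

lemma phased_flags:
  assumes "complex_hadamard q E" "complex_hadamard k F" "complex_hadamard (r + 1) G"
  shows "phased_flags q k r E F G \<sigma> w"
proof (rule phased_flags.intro, unfold v_eq[symmetric])
  show "q > 0" "k > 0" "r > 0" by (fact pos)+
  show "inj_on (\<lambda>c. \<sigma> c j) {..<r}" if "j < v" for j
  proof (rule inj_onI)
    \<comment> \<open>Equal ranks at one vertex give the same block, whose class is then both
      \<open>c\<close> and \<open>c'\<close>.\<close>
    fix c c' assume c: "c \<in> {..<r}" "c' \<in> {..<r}" and eq: "\<sigma> c j = \<sigma> c' j"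
    then have "c < r" "c' < r" by auto
    from this[THEN \<sigma>(2)[OF _ that]] show "c = c'" unfolding eq by simp
  qed
  show "w c j < v" for c j
    unfolding w_def v_eq using pos by simp
  show "\<sigma> c j < r" if "c < r" "j < v" for c j
    by (rule \<sigma>(1)[OF that])
  show "\<exists>!c. c < r \<and> w c j div k = w c j' div k" if "j < v" "j' < v" "j \<noteq> j'" for j j'
    by (rule joined_once[OF that])
qed (fact assms w_inj)+

section \<open>Identification with the matrix products\<close>

context
  fixes E F G :: "complex mat"
  assumes E: "complex_hadamard q E" and F: "complex_hadamard k F" and G: "complex_hadamard (r + 1) G"
begin

interpretation flags: phased_flags q k r E F G \<sigma> w
  by (rule phased_flags[OF E F G])

lemma Psi_mat_eq:
  assumes l: "l < k"
  shows "Psi_mat v r b E F G (mat (b * k) (b * k) (\<lambda>(i, j). if i = p j then 1 else 0)) l = flags.Psi l"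
proof -
  let ?P = "mat (b * k) (b * k) (\<lambda>(i, j). if i = p j then 1 else 0) :: complex mat"
  define G1 where "G1 = mat_of_cols (r + 1) (map (col G) [0..<r])"
  define f where "f = mat_adjoint (col_mat F l)"
  have G1: "G1 \<in> carrier_mat (r + 1) r" unfolding G1_def carrier_mat_def by simp
  have G1_entry: "mat_adjoint G1 $$ (s, m) = cnj (G $$ (m, s))" if "m < r + 1" "s < r" for m s
    using adjoint_entry[OF G1 that(2,1)] that hadamard_carrier[OF G]
    unfolding G1_def by (simp add: mat_of_cols_index)
  have f: "f \<in> carrier_mat 1 k"
    unfolding f_def by (rule col_mat_adjoint[OF hadamard_carrier[OF F] l])
  have f_entry: "f $$ (0, t) = cnj (F $$ (t, l))" if "t < k" for t
    unfolding f_def by (rule col_mat_adjoint(2)[OF hadamard_carrier[OF F] l that])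
  have Ec: "1\<^sub>m r \<otimes>\<^sub>k E \<in> carrier_mat b b"
    using kron_carrier[OF one_carrier_mat hadamard_carrier[OF E], of r] unfolding b_eq .
  have fc: "1\<^sub>m b \<otimes>\<^sub>k f \<in> carrier_mat b (b * k)"
    using kron_carrier[OF one_carrier_mat f, of b] by simp
  let ?M = "(1\<^sub>m r \<otimes>\<^sub>k E) * (1\<^sub>m b \<otimes>\<^sub>k f)"
  have M: "?M \<in> carrier_mat b (b * k)" by (rule mult_carrier_mat[OF Ec fc])
  have MP: "?M * ?P \<in> carrier_mat b (v * r)"
    using mult_carrier_mat[OF M mat_carrier] bk by simp
  \<comment> \<open>Flag \<open>y\<close> lies in block \<open>y div k\<close>, so the second factor
    has its only nonzero entry of column \<open>y\<close> in that row, and the first factor links it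
    to row \<open>a\<close> only within one class.\<close>
  have M_entry: "?M $$ (a, y) = (if y div k div q = a div q
      then E $$ (a mod q, y div k mod q) * cnj (F $$ (y mod k, l)) else 0)"
    if a: "a < b" and y: "y < b * k" for a y
  proof -
    have c: "a div q < r" using a unfolding b_eq by (rule div_less_of_less_mult)
    have fe: "(1\<^sub>m b \<otimes>\<^sub>k f) $$ (a div q * q + t, y)
        = (if t = y div k mod q then if y div k div q = a div q then cnj (F $$ (y mod k, l)) else 0 else 0)"
      if t: "t < q" for t
    proof -
      have "a div q * q + t < b * 1" using mult_add_less_mult[OF c t] unfolding b_eq by simp
      moreover have "a div q * q + t = y div k \<longleftrightarrow> t = y div k mod q \<and> y div k div q = a div q"
      proof
        assume "a div q * q + t = y div k"
        from this[symmetric] show "t = y div k mod q \<and> y div k div q = a div q"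
          using t by simp
      next
        assume "t = y div k mod q \<and> y div k div q = a div q"
        then show "a div q * q + t = y div k"
          using div_mult_mod_eq[of "y div k" q] by metis
      qed
      ultimately show ?thesis
        using one_kron_entry[OF f _ y, of "a div q * q + t"] y pos
        by (auto simp: f_entry)
    qed
    have "?M $$ (a, y) = (\<Sum>t<q. E $$ (a mod q, t) * (1\<^sub>m b \<otimes>\<^sub>k f) $$ (a div q * q + t, y))"
      using one_kron_times_entry[OF hadamard_carrier[OF E], of "1\<^sub>m b \<otimes>\<^sub>k f" r "b * k" a y] fc a y
      unfolding b_eq by simp
    also have "\<dots> = (\<Sum>t<q. if t = y div k mod q then if y div k div q = a div q
        then E $$ (a mod q, t) * cnj (F $$ (y mod k, l)) else 0 else 0)"
      by (intro sum.cong refl) (simp only: fe lessThan_iff, simp)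
    also have "\<dots> = (if y div k div q = a div q
        then E $$ (a mod q, y div k mod q) * cnj (F $$ (y mod k, l)) else 0)"
      using pos by simp
    finally show ?thesis .
  qed
  have "Psi_mat v r b E F G ?P l = ?M * ?P * (1\<^sub>m v \<otimes>\<^sub>k mat_adjoint G1)"
    unfolding Psi_mat_def Let_def G1_def f_def ..
  also have "\<dots> = flags.Psi l"
  proof (rule eq_matI)
    have dims: "?M * ?P * (1\<^sub>m v \<otimes>\<^sub>k mat_adjoint G1) \<in> carrier_mat b (v * (r + 1))"
      by (rule mult_carrier_mat[OF MP kron_carrier[OF one_carrier_mat adjoint_carrier[OF G1]]])
    have Psi_dims: "flags.Psi l \<in> carrier_mat b (v * (r + 1))"
      using flags.Psi_carrier[of l] b_eq v_eq by simp
    show "dim_row (?M * ?P * (1\<^sub>m v \<otimes>\<^sub>k mat_adjoint G1)) = dim_row (flags.Psi l)"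
      "dim_col (?M * ?P * (1\<^sub>m v \<otimes>\<^sub>k mat_adjoint G1)) = dim_col (flags.Psi l)"
      using dims Psi_dims by (metis carrier_matD)+
    fix a x assume "a < dim_row (flags.Psi l)" "x < dim_col (flags.Psi l)"
    then have a: "a < b" and x: "x < v * (r + 1)"
      using Psi_dims by (metis carrier_matD)+
    define j m c where jmc: "j = x div (r + 1)" "m = x mod (r + 1)" "c = a div q"
    have j: "j < v" and m: "m < r + 1" and c: "c < r"
      using a x unfolding jmc b_eq by (auto intro: div_less_of_less_mult)
    have s_less: "\<sigma> c j < r" by (rule \<sigma>(1)[OF c j])
    \<comment> \<open>Among the \<open>r\<close> flags at vertex \<open>j\<close>, only the one in
      the class of row \<open>a\<close> survives, so the later product with \<open>G1\<close> picks
      out a single column of \<open>G\<close>.\<close>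
    have MP_entry: "(?M * ?P) $$ (a, j * r + s) = (if s = \<sigma> c j
        then E $$ (a mod q, block j s mod q) * cnj (F $$ (flag j s mod k, l)) else 0)" if s: "s < r" for s
    proof -
      have z: "j * r + s < b * k" using mult_add_less_mult[OF j s] bk by simp
      have "(?M * ?P) $$ (a, j * r + s) = ?M $$ (a, flag j s)"
        unfolding flag_def by (rule times_permutation_entry[OF M p a z])
      also have "\<dots> = (if block j s div q = c
          then E $$ (a mod q, block j s mod q) * cnj (F $$ (flag j s mod k, l)) else 0)"
        unfolding M_entry[OF a flag_less[OF j s]] block_def jmc(3) ..
      finally show ?thesis unfolding \<sigma>_iff[OF c j s] .
    qed
    have "(?M * ?P * (1\<^sub>m v \<otimes>\<^sub>k mat_adjoint G1)) $$ (a, x)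
        = (\<Sum>s<r. (?M * ?P) $$ (a, j * r + s) * mat_adjoint G1 $$ (s, m))"
      unfolding jmc by (rule times_one_kron_entry[OF MP adjoint_carrier[OF G1] a x])
    also have "\<dots> = (\<Sum>s<r. if s = \<sigma> c j then E $$ (a mod q, block j s mod q)
        * cnj (F $$ (flag j s mod k, l)) * cnj (G $$ (m, s)) else 0)"
      by (intro sum.cong refl) (simp only: MP_entry G1_entry[OF m] lessThan_iff, simp)
    also have "\<dots> = E $$ (a mod q, block j (\<sigma> c j) mod q)
        * cnj (F $$ (flag j (\<sigma> c j) mod k, l)) * cnj (G $$ (m, \<sigma> c j))"
      using s_less by simp
    also have "\<dots> = flags.Psi l $$ (a, x)"
      using a x unfolding flags.Psi_def flags.phase_def w_div w_mod jmc b_eq v_eq[symmetric] by simp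
    finally show "(?M * ?P * (1\<^sub>m v \<otimes>\<^sub>k mat_adjoint G1)) $$ (a, x) = flags.Psi l $$ (a, x)" .
  qed
  finally show ?thesis .
qed

lemma rest_eq: "(E \<otimes>\<^sub>k F) * (1\<^sub>m v \<otimes>\<^sub>k mat_adjoint (col_mat G r)) = flags.rest"
proof (rule eq_matI)
  \<comment> \<open>Writing the width as \<open>v * 1\<close> treats the adjoint of the last column
    of \<open>G\<close> as a block of height 1, whose sum has one term.\<close>
  have EF: "E \<otimes>\<^sub>k F \<in> carrier_mat v (v * 1)"
    using kron_carrier[OF hadamard_carrier[OF E] hadamard_carrier[OF F]] unfolding v_eq by simp
  have r: "r < r + 1" by simp
  note g = col_mat_adjoint[OF hadamard_carrier[OF G] r]
  have dims: "(E \<otimes>\<^sub>k F) * (1\<^sub>m v \<otimes>\<^sub>k mat_adjoint (col_mat G r)) \<in> carrier_mat v (v * (r + 1))"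
    by (rule mult_carrier_mat[OF EF kron_carrier[OF one_carrier_mat g(1)]])
  have rest_dims: "flags.rest \<in> carrier_mat v (v * (r + 1))"
    using flags.rest_carrier v_eq by simp
  show "dim_row ((E \<otimes>\<^sub>k F) * (1\<^sub>m v \<otimes>\<^sub>k mat_adjoint (col_mat G r))) = dim_row flags.rest"
    "dim_col ((E \<otimes>\<^sub>k F) * (1\<^sub>m v \<otimes>\<^sub>k mat_adjoint (col_mat G r))) = dim_col flags.rest"
    using dims rest_dims by (metis carrier_matD)+
  fix a x assume "a < dim_row flags.rest" "x < dim_col flags.rest"
  then have a: "a < v" and x: "x < v * (r + 1)"
    using rest_dims by (metis carrier_matD)+
  have j: "x div (r + 1) < v" using x by (rule div_less_of_less_mult)
  have "((E \<otimes>\<^sub>k F) * (1\<^sub>m v \<otimes>\<^sub>k mat_adjoint (col_mat G r))) $$ (a, x)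
      = (E \<otimes>\<^sub>k F) $$ (a, x div (r + 1)) * cnj (G $$ (x mod (r + 1), r))"
    using times_one_kron_entry[OF EF g(1) a x] g(2)[of "x mod (r + 1)"] by simp
  also have "\<dots> = flags.rest $$ (a, x)"
    using a x j kron_entry[OF hadamard_carrier[OF E] hadamard_carrier[OF F], of a "x div (r + 1)"]
    unfolding flags.rest_def v_eq[symmetric] by simp
  finally show "((E \<otimes>\<^sub>k F) * (1\<^sub>m v \<otimes>\<^sub>k mat_adjoint (col_mat G r))) $$ (a, x) = flags.rest $$ (a, x)" .
qed

lemma Psi_compl_eq:
  "Psi_compl v k r b E F G (mat (b * k) (b * k) (\<lambda>(i, j). if i = p j then 1 else 0)) = flags.compl"
proof -
  have maps: "map (Psi_mat v r b E F G (mat (b * k) (b * k) (\<lambda>(i, j). if i = p j then 1 else 0))) [1..<k]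
      = map flags.Psi [1..<k]"
    using Psi_mat_eq by (intro map_cong) auto
  show ?thesis
    unfolding Psi_compl_def flags.compl_def rest_eq maps ..
qed

lemma Psi_conclusions:
  fixes K :: "complex set"
  defines "P \<equiv> mat (b * k) (b * k) (\<lambda>(i, j). if i = p j then 1 else 0)"
  assumes K: "K = (if elements_mat E \<subseteq> \<real> \<and> elements_mat F \<subseteq> \<real> \<and> elements_mat G \<subseteq> \<real> then \<real> else UNIV)"
  shows "let \<Psi> = Psi_mat v r b E F G P; \<Psi>' = Psi_compl v k r b E F G P; n = v * (r + 1) in
       (\<forall>l<k. etf K b n (\<Psi> l) \<and> flat_mat (\<Psi> l))
     \<and> (\<forall>l<k. \<forall>m<k. l \<noteq> m \<longrightarrow>
          orthogonal_sets (row_space_over K (\<Psi> l)) (row_space_over K (\<Psi> m)))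
     \<and> naimark_complement K b n (\<Psi> 0) \<Psi>' \<and> flat_mat \<Psi>'
     \<and> (if K = \<real> then real_hadamard_etf b n (\<Psi> 0) else complex_hadamard_etf b n (\<Psi> 0))"
proof -
  note c = flags.conclusions[OF K, unfolded b_eq[symmetric] v_eq[symmetric]]
  show ?thesis
    unfolding Let_def P_def Psi_compl_eq Psi_mat_eq[OF pos(2)]
    by (intro conjI allI impI; (simp only: Psi_mat_eq)?; use c in blast)
qed

end

end

section \<open>Round-robin tournaments\<close>

text \<open>
  The one-factorization of the complete graph on \<open>2 * u\<close> vertices: in round \<open>c\<close> the vertex
  \<open>2 * u - 1\<close> meets \<open>c\<close>, and \<open>c + d\<close> meets \<open>c - d\<close> modulo \<open>2 * u - 1\<close>.  The \<open>d\<close>-th pair of a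
  round occupies the places \<open>2 * d\<close> and \<open>2 * d + 1\<close>.
\<close>

definition round_robin_shift :: "nat \<Rightarrow> nat \<Rightarrow> nat \<Rightarrow> nat" where
  "round_robin_shift u c j = (if c \<le> j then j - c else j + (2 * u - 1) - c)"

definition round_robin :: "nat \<Rightarrow> nat \<Rightarrow> nat \<Rightarrow> nat" where
  "round_robin u c j = (if j = 2 * u - 1 then 1
     else let d = round_robin_shift u c j in if d < u then 2 * d else 2 * (2 * u - 1 - d) + 1)"

lemma round_robin_less:
  assumes "c < 2 * u - 1" "j < 2 * u"
  shows "round_robin u c j < 2 * u"
  using assms unfolding round_robin_def round_robin_shift_def Let_def by auto

text \<open>Parity of the place tells which half of the residues is meant, and place 1 is kept for
  the vertex \<open>2 * u - 1\<close>.\<close>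

lemma round_robin_inj:
  assumes "c < 2 * u - 1"
  shows "inj_on (round_robin u c) {..<2 * u}"
proof (rule inj_onI)
  fix j j' assume j: "j \<in> {..<2 * u}" "j' \<in> {..<2 * u}" and eq: "round_robin u c j = round_robin u c j'"
  have shift: "i \<noteq> 2 * u - 1 \<Longrightarrow> round_robin_shift u c i < 2 * u - 1" if "i < 2 * u" for i
    using that assms unfolding round_robin_shift_def by auto
  let ?val = "\<lambda>d. if d < u then 2 * d else 2 * (2 * u - 1 - d) + 1"
  \<comment> \<open>A residue is at most \<open>2 * u - 2\<close>, so the odd places it can yield
    start at 3.\<close>
  have val_1: "?val d \<noteq> 1" if "d < 2 * u - 1" for d
    using that by (cases "d < u") auto
  have val_inj: "d = e" if d: "d < 2 * u - 1" "e < 2 * u - 1" and eq: "?val d = ?val e" for d e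
  proof -
    have "even (?val d) \<longleftrightarrow> d < u" "even (?val e) \<longleftrightarrow> e < u" by auto
    then have "d < u \<longleftrightarrow> e < u" unfolding eq by blast
    then show ?thesis using d eq by (cases "d < u") auto
  qed
  have val: "round_robin u c i = (if i = 2 * u - 1 then 1 else ?val (round_robin_shift u c i))" for i
    unfolding round_robin_def Let_def ..
  have "j = 2 * u - 1 \<longleftrightarrow> j' = 2 * u - 1"
  proof (rule ccontr)
    assume "\<not> ?thesis"
    then consider "j = 2 * u - 1" "j' \<noteq> 2 * u - 1" | "j \<noteq> 2 * u - 1" "j' = 2 * u - 1" by blast
    then show False
    proof cases
      case 1
      then show False using eq val[of j] val[of j'] val_1[OF shift[of j']] j(2) by simp
    next
      case 2
      then show False using eq val[of j] val[of j'] val_1[OF shift[of j]] j(1) by simp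
    qed
  qed
  moreover have "round_robin_shift u c j = round_robin_shift u c j'" if ne: "j \<noteq> 2 * u - 1" "j' \<noteq> 2 * u - 1"
  proof (rule val_inj[OF shift[OF _ ne(1)] shift[OF _ ne(2)]])
    show "?val (round_robin_shift u c j) = ?val (round_robin_shift u c j')"
      using eq ne val[of j] val[of j'] by presburger
  qed (use j in auto)
  moreover have "j = j'" if "j < 2 * u - 1" "j' < 2 * u - 1"
    "round_robin_shift u c j = round_robin_shift u c j'"
    using that assms unfolding round_robin_shift_def by (auto split: if_splits)
  ultimately show "j = j'" using j by (cases "j = 2 * u - 1") auto
qed

text \<open>Distinct residues form a pair exactly when they are opposite modulo
  \<open>2 * u - 1\<close>. The alternatives are the wraparounds of \<open>j + j'\<close> being
  congruent to \<open>2 * c\<close>.\<close>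

lemma round_robin_same_pair:
  assumes c: "c < 2 * u - 1" and j: "j < 2 * u - 1" "j' < 2 * u - 1" "j \<noteq> j'"
  shows "round_robin u c j div 2 = round_robin u c j' div 2
    \<longleftrightarrow> j + j' = 2 * c \<or> j + j' + (2 * u - 1) = 2 * c \<or> j + j' = 2 * c + (2 * u - 1)"
proof -
  define d d' where d: "d = round_robin_shift u c j" "d' = round_robin_shift u c j'"
  have half: "round_robin u c i div 2 = (if round_robin_shift u c i < u then round_robin_shift u c i
      else 2 * u - 1 - round_robin_shift u c i)" if "i < 2 * u - 1" for i
    using that unfolding round_robin_def Let_def by auto
  have less: "d < 2 * u - 1" "d' < 2 * u - 1" and ne: "d \<noteq> d'"
    using c j unfolding d round_robin_shift_def by auto
  have "round_robin u c j div 2 = round_robin u c j' div 2 \<longleftrightarrow> d + d' = 2 * u - 1"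
    using less ne unfolding half[OF j(1)] half[OF j(2)] d[symmetric] by auto
  also have "\<dots> \<longleftrightarrow> j + j' = 2 * c \<or> j + j' + (2 * u - 1) = 2 * c \<or> j + j' = 2 * c + (2 * u - 1)"
    using c j unfolding d round_robin_shift_def by auto
  finally show ?thesis .
qed

text \<open>Residue 0 occupies place 0, next to place 1 of the last vertex, and it arises only for
  \<open>j = c\<close>.\<close>

lemma round_robin_infinity:
  assumes c: "c < 2 * u - 1" and j: "j < 2 * u - 1"
  shows "round_robin u c j div 2 = round_robin u c (2 * u - 1) div 2 \<longleftrightarrow> c = j"
  using assms unfolding round_robin_def round_robin_shift_def Let_def by auto

text \<open>For two finite vertices the round must satisfy \<open>2 * c\<close> congruent to
  \<open>j + j'\<close> modulo an odd number, where 2 is invertible. If one is the last vertex, the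
  round is the other.\<close>

lemma round_robin_once:
  assumes j: "j < 2 * u" "j' < 2 * u" "j \<noteq> j'"
  shows "\<exists>!c. c < 2 * u - 1 \<and> round_robin u c j div 2 = round_robin u c j' div 2"
proof -
  consider "j = 2 * u - 1" "j' < 2 * u - 1" | "j' = 2 * u - 1" "j < 2 * u - 1"
    | "j < 2 * u - 1" "j' < 2 * u - 1"
    using j by linarith
  then show ?thesis
  proof cases
    case 1
    have "round_robin u c j div 2 = round_robin u c j' div 2 \<longleftrightarrow> c = j'" if "c < 2 * u - 1" for c
      unfolding 1(1) round_robin_infinity[OF that 1(2), symmetric] by (rule eq_commute)
    then show ?thesis using 1(2) by blast
  next
    case 2
    have "round_robin u c j div 2 = round_robin u c j' div 2 \<longleftrightarrow> c = j" if "c < 2 * u - 1" for c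
      unfolding 2(1) by (rule round_robin_infinity[OF that 2(2)])
    then show ?thesis using 2(2) by blast
  next
    case 3
    define N where "N = 2 * u - 1"
    have less: "j < N" "j' < N" using 3 by (auto simp: N_def)
    \<comment> \<open>That \<open>j < N\<close> forces \<open>u > 0\<close>, so the subtraction in
      \<open>2 * u - 1\<close> is not truncated.\<close>
    have "odd N" using less by (auto simp: N_def)
    then obtain m where m: "N = 2 * m + 1" by (rule oddE)
    have "\<exists>!c. c < N \<and> (j + j' = 2 * c \<or> j + j' + N = 2 * c \<or> j + j' = 2 * c + N)"
    proof (cases "even (j + j')")
      case True
      then obtain d where d: "j + j' = 2 * d" by (rule evenE)
      have "d < N" using d less by linarith
      moreover have "c = d" if "2 * d = 2 * c \<or> 2 * d + (2 * m + 1) = 2 * c \<or> 2 * d = 2 * c + (2 * m + 1)" for c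
        using that by presburger
      ultimately show ?thesis unfolding d m by blast
    next
      case False
      then obtain d where d: "j + j' = 2 * d + 1" by (rule oddE)
      have "d < N" using d less by linarith
      \<comment> \<open>Parity excludes the unwrapped alternative. Of the other two solutions,
        \<open>d + m + 1\<close> lies below \<open>2 * m + 1\<close> exactly when
        \<open>d < m\<close>, and \<open>d - m\<close> serves otherwise.\<close>
      have c_iff: "2 * d + 1 = 2 * c \<or> 2 * d + 1 + (2 * m + 1) = 2 * c \<or> 2 * d + 1 = 2 * c + (2 * m + 1)
          \<longleftrightarrow> c = d + m + 1 \<or> c + m = d" for c
        by presburger
      show ?thesis
      proof (cases "d < m")
        case True
        then show ?thesis unfolding d m c_iff by (intro ex1I[of _ "d + m + 1"]) auto
      next
        case False
        then show ?thesis using \<open>d < N\<close> unfolding d m c_iff by (intro ex1I[of _ "d - m"]) auto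
      qed
    qed
    then show ?thesis
      unfolding N_def using round_robin_same_pair[OF _ 3 j(3)] by metis
  qed
qed

section \<open>Real Hadamard frames from a real Hadamard matrix\<close>

definition sylvester2 :: "complex mat" where
  "sylvester2 = mat 2 2 (\<lambda>(i, j). if i = 1 \<and> j = 1 then -1 else 1)"

lemma hadamard_sylvester2: "complex_hadamard 2 sylvester2"
proof (rule hadamardI)
  fix i j :: nat assume ij: "i < 2" "j < 2"
  show "cmod (sylvester2 $$ (i, j)) = 1"
    using ij unfolding sylvester2_def by simp
  have "i = 0 \<or> i = 1" "j = 0 \<or> j = 1" using ij by auto
  then show "(\<Sum>x<2. sylvester2 $$ (i, x) * cnj (sylvester2 $$ (j, x))) = (if i = j then of_nat 2 else 0)"
    unfolding sylvester2_def by (auto simp: numeral_2_eq_2)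
qed (simp add: sylvester2_def)

lemma sylvester2_real: "elements_mat sylvester2 \<subseteq> \<real>"
  unfolding sylvester2_def by (auto elim!: elements_matE[OF _ mat_carrier])

lemma kron_real:
  assumes A: "A \<in> carrier_mat m n" "elements_mat A \<subseteq> \<real>" and B: "B \<in> carrier_mat p s" "elements_mat B \<subseteq> \<real>"
  shows "elements_mat (A \<otimes>\<^sub>k B) \<subseteq> \<real>"
proof
  fix z assume "z \<in> elements_mat (A \<otimes>\<^sub>k B)"
  then obtain i j where ij: "i < m * p" "j < n * s" "z = (A \<otimes>\<^sub>k B) $$ (i, j)"
    using kron_carrier[OF A(1) B(1)] by (rule elements_matE)
  have "A $$ (i div p, j div s) \<in> elements_mat A" "B $$ (i mod p, j mod s) \<in> elements_mat B"
    using ij by (auto intro!: elements_matI[OF A(1)] elements_matI[OF B(1)] div_less_of_less_mult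
        mod_less_of_less_mult)
  then show "z \<in> \<real>"
    using A(2) B(2) unfolding ij(3) kron_entry[OF A(1) B(1) ij(1,2)] by (blast intro: Reals_mult)
qed

text \<open>Settles \<open>u = 0\<close>, where the empty matrix counts as Hadamard of size
  0.\<close>

lemma real_hadamard_etf_0: "real_hadamard_etf 0 0 (0\<^sub>m 0 0)"
proof -
  have "complex_hadamard 0 (0\<^sub>m 0 0)"
    by (rule hadamardI) auto
  then have "real_hadamard 0 (0\<^sub>m 0 0)"
    by (rule real_hadamardI) (auto elim!: elements_matE[OF _ zero_carrier_mat])
  moreover have "0\<^sub>m 0 0 = submatrix (0\<^sub>m 0 0 :: complex mat) {} {}"
    by (intro eq_matI) (auto simp: submatrix_def)
  moreover have "mat_adjoint (0\<^sub>m 0 0 :: complex mat) \<in> carrier_mat 0 0"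
    by (rule adjoint_carrier) simp
  \<comment> \<open>All three frame constants may be taken as 1, since there are no vectors to
    constrain them.\<close>
  then have "etf \<real> 0 0 (0\<^sub>m 0 0)"
    unfolding etf_def mat_over_def
    by (intro conjI exI[of _ 1]) (auto elim!: elements_matE[OF _ zero_carrier_mat] intro!: eq_matI)
  ultimately show ?thesis
    unfolding real_hadamard_etf_def by blast
qed

lemma real_hadamard_etf_exists:
  assumes H: "real_hadamard u H"
  shows "\<exists>\<Phi>. real_hadamard_etf (u * (2 * u - 1)) (4 * u\<^sup>2) \<Phi>"
proof (cases "u = 0")
  case True
  then show ?thesis using real_hadamard_etf_0 by auto
next
  case False
  have Hc: "complex_hadamard u H" and Hr: "elements_mat H \<subseteq> \<real>"
    using H unfolding real_hadamard_def by (auto dest!: subsetD)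
  have G: "complex_hadamard (2 * u - 1 + 1) (sylvester2 \<otimes>\<^sub>k H)"
    using complex_hadamard_kron[OF hadamard_sylvester2 Hc] False by simp
  \<comment> \<open>The classes are the \<open>2 * u - 1\<close> rounds on \<open>2 * u\<close>
    vertices with pairs as blocks. Every vertex plays in each round, so the round serves as its
    rank. The Hadamard sizes are \<open>u\<close>, 2 and \<open>2 * u\<close>, the last obtained by
    doubling \<open>H\<close>.\<close>
  interpret rr: phased_flags u 2 "2 * u - 1" H sylvester2 "sylvester2 \<otimes>\<^sub>k H" "\<lambda>c j. c" "round_robin u"
    by unfold_locales
      (use False Hc hadamard_sylvester2 G round_robin_less round_robin_inj round_robin_once
        in \<open>auto simp: mult.commute[of u 2]\<close>)
  have "rr.scalars_real"
    unfolding rr.scalars_real_def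
    using Hr sylvester2_real kron_real[OF hadamard_carrier[OF hadamard_sylvester2] _ hadamard_carrier[OF Hc]]
    by blast
  then have "real_hadamard_etf ((2 * u - 1) * u) (u * 2 * (2 * u - 1 + 1)) (rr.Psi 0)"
    by (rule rr.real_hadamard_etf_Psi)
  moreover have "u * 2 * (2 * u - 1 + 1) = 4 * u\<^sup>2"
    using False by (simp add: power2_eq_square)
  ultimately show ?thesis by (auto simp: mult.commute[of u])
qed

theorem theorem2:
  "(\<forall>(V :: 'a set) vs Bs v k r b P E F G K.
      rbibd V Bs v k 1 r b \<longrightarrow>
      consecutive_classes V Bs v k r \<longrightarrow>
      distinct vs \<longrightarrow> set vs = V \<longrightarrow>
      bibd_permutation_mat v k r b (incidence_mat vs Bs) P \<longrightarrow>
      complex_hadamard (v div k) E \<longrightarrow>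
      complex_hadamard k F \<longrightarrow>
      complex_hadamard (r + 1) G \<longrightarrow>
      K = (if elements_mat E \<subseteq> \<real> \<and> elements_mat F \<subseteq> \<real> \<and> elements_mat G \<subseteq> \<real>
           then \<real> else UNIV) \<longrightarrow>
      (let \<Psi> = Psi_mat v r b E F G P; \<Psi>' = Psi_compl v k r b E F G P; n = v * (r + 1) in
         (\<forall>l<k. etf K b n (\<Psi> l) \<and> flat_mat (\<Psi> l))
       \<and> (\<forall>l<k. \<forall>m<k. l \<noteq> m \<longrightarrow>
            orthogonal_sets (row_space_over K (\<Psi> l)) (row_space_over K (\<Psi> m)))
       \<and> naimark_complement K b n (\<Psi> 0) \<Psi>' \<and> flat_mat \<Psi>'
       \<and> (if K = \<real> then real_hadamard_etf b n (\<Psi> 0) else complex_hadamard_etf b n (\<Psi> 0))))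
   \<and> (\<forall>u::nat. (\<exists>H. real_hadamard u H) \<longrightarrow>
        (\<exists>\<Phi>. real_hadamard_etf (u * (2 * u - 1)) (4 * u\<^sup>2) \<Phi>))"
proof (intro conjI allI impI)
  fix V :: "'a set" and vs Bs v k r b P E F G and K :: "complex set"
  assume rbibd: "rbibd V Bs v k 1 r b" and cons: "consecutive_classes V Bs v k r"
    and vs: "distinct vs" "set vs = V"
    and P: "bibd_permutation_mat v k r b (incidence_mat vs Bs) P"
    and EFG: "complex_hadamard (v div k) E" "complex_hadamard k F" "complex_hadamard (r + 1) G"
    and K: "K = (if elements_mat E \<subseteq> \<real> \<and> elements_mat F \<subseteq> \<real> \<and> elements_mat G \<subseteq> \<real>
           then \<real> else UNIV)"
  obtain p where p: "p permutes {..<b * k}"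
    and P_eq: "P = mat (b * k) (b * k) (\<lambda>(i, j). if i = p j then 1 else 0)"
    using P unfolding bibd_permutation_mat_def permutation_mat_def by blast
  have flags: "flag_permutation V vs Bs v k r b (v div k) p"
  proof (rule flag_permutation.intro[OF refl _ cons vs p])
    show "bibd V Bs v k 1 r b" using rbibd unfolding rbibd_def by blast
  qed (use P in \<open>unfold bibd_permutation_mat_def P_eq, blast\<close>)
  show "let \<Psi> = Psi_mat v r b E F G P; \<Psi>' = Psi_compl v k r b E F G P; n = v * (r + 1) in
         (\<forall>l<k. etf K b n (\<Psi> l) \<and> flat_mat (\<Psi> l))
       \<and> (\<forall>l<k. \<forall>m<k. l \<noteq> m \<longrightarrow>
            orthogonal_sets (row_space_over K (\<Psi> l)) (row_space_over K (\<Psi> m)))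
       \<and> naimark_complement K b n (\<Psi> 0) \<Psi>' \<and> flat_mat \<Psi>'
       \<and> (if K = \<real> then real_hadamard_etf b n (\<Psi> 0) else complex_hadamard_etf b n (\<Psi> 0))"
    unfolding P_eq by (rule flag_permutation.Psi_conclusions[OF flags EFG K])
qed (blast intro: real_hadamard_etf_exists)

end
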